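(* The set $P=\{A\in F(\ell_2)\mid A\text{ is purely unrectifiable}\}$ is $\Pi^1_1$-complete (as a subset of $F(\ell_2)$, the space of all closed subsets of $\ell_2$).
   Context: $\ell_2$ is the (real, separable, infinite-dimensional) Hilbert space of square-summable sequences with norm $\|\cdot\|_2$. $C^1$-curves. A Fréchet derivative of $f\colon[0,1]\to\ell_2$ at $x\in[0,1]$ is a linear operator $A_x\colon\mathbb{R}\to\ell_2$ such that $\lim_{h\to 0}\frac{\|f(x+h)-f(x)-A_xh\|_2}{|h|}=0$ (with $x+h\in[0,1]$). The function $f$ is $C^1$ if the Fréchet derivative exists at every point of $[0,1]$ and the map $x\mapsto A_x$ is continuous in the operator norm. Purely unrectifiable sets. A subset $N\subset\ell_2$ is purely unrectifiable (short for purely $1$-unrectifiable) if for every $C^1$-map $f\colon[0,1]\to\ell_2$ we have $\mathcal{H}^1(N\cap\operatorname{ran}(f))=0$, where $\mathcal{H}^1$ is the one-dimensional Hausdorff measure and $\operatorname{ran}(f)$ is the range of $f$. The space $F(\ell_2)$. $F(\ell_2)$ is the set of all closed subsets of $\ell_2$. It is a standard Borel space with the $\sigma$-algebra generated by the sets $\{A\in F(\ell_2)\mid A\cap U\neq\varnothing\}$, where $U$ ranges over the basic open subsets of $\ell_2$. It is regarded as a Polish space via a Polish topology whose Borel sets are exactly this $\sigma$-algebra. Descriptive set theory. A subset $A$ of a Polish space $X$ is $\Sigma^1_1$ if there are a Polish space $Y$ and a Borel set $B\subset X\times Y$ such that $A$ is the projection of $B$ to $X$; it is $\Pi^1_1$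 if it is the complement of a $\Sigma^1_1$ set. For Polish spaces $X,Y$, a set $A\subset X$ is Borel Wadge-reducible to $B\subset Y$, written $A\le_W B$, if there is a Borel function $f\colon X\to Y$ such that for all $x\in X$, $x\in A\iff f(x)\in B$. A set $A$ in a Polish space is $\Pi^1_1$-hard if every $\Pi^1_1$ set $B$ (in any Polish space) satisfies $B\le_W A$. A set is $\Pi^1_1$-complete if it is $\Pi^1_1$ and $\Pi^1_1$-hard. *)

theory Defs
  imports "HOL-Analysis.Analysis"
begin

section \<open>The Hilbert space of square-summable real sequences\<close>

typedef ell2 = "{x :: nat \<Rightarrow> real. summable (\<lambda>i. (x i)\<^sup>2)}"
  morphisms coord Abs_ell2
  by (rule exI[of _ "\<lambda>_. 0"]) simp

setup_lifting type_definition_ell2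

lemma summable_coord_square: "summable (\<lambda>i. (coord x i)\<^sup>2)"
  using coord by blast

lemma square_summable_add:
  fixes x y :: "nat \<Rightarrow> real"
  assumes "summable (\<lambda>i. (x i)\<^sup>2)" "summable (\<lambda>i. (y i)\<^sup>2)"
  shows "summable (\<lambda>i. (x i + y i)\<^sup>2)"
proof (rule summable_comparison_test')
  show "summable (\<lambda>i. 2 * (x i)\<^sup>2 + 2 * (y i)\<^sup>2)"
    using assms by (intro summable_add summable_mult)
  fix i
  have "(x i + y i)\<^sup>2 + (x i - y i)\<^sup>2 = 2 * (x i)\<^sup>2 + 2 * (y i)\<^sup>2"
    by (simp add: power2_eq_square algebra_simps)
  then have "(x i + y i)\<^sup>2 \<le> 2 * (x i)\<^sup>2 + 2 * (y i)\<^sup>2"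
    by (smt (verit) zero_le_power2)
  then show "norm ((x i + y i)\<^sup>2) \<le> 2 * (x i)\<^sup>2 + 2 * (y i)\<^sup>2"
    by simp
qed

lemma summable_coord_mult: "summable (\<lambda>i. coord x i * coord y i)"
proof (rule summable_comparison_test')
  show "summable (\<lambda>i. (coord x i)\<^sup>2 + (coord y i)\<^sup>2)"
    by (intro summable_add summable_coord_square)
  fix i
  have "2 * (\<bar>coord x i\<bar> * \<bar>coord y i\<bar>) \<le> (coord x i)\<^sup>2 + (coord y i)\<^sup>2"
    using sum_squares_bound[of "\<bar>coord x i\<bar>" "\<bar>coord y i\<bar>"] by simp
  moreover have "0 \<le> \<bar>coord x i\<bar> * \<bar>coord y i\<bar>" by simp
  ultimately show "norm (coord x i * coord y i) \<le> (coord x i)\<^sup>2 + (coord y i)\<^sup>2"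
    unfolding real_norm_def abs_mult by linarith
qed

instantiation ell2 :: real_vector
begin

lift_definition zero_ell2 :: ell2 is "\<lambda>_. 0" by simp

lift_definition plus_ell2 :: "ell2 \<Rightarrow> ell2 \<Rightarrow> ell2" is "\<lambda>x y i. x i + y i"
  by (rule square_summable_add)

lift_definition uminus_ell2 :: "ell2 \<Rightarrow> ell2" is "\<lambda>x i. - x i" by simp

lift_definition scaleR_ell2 :: "real \<Rightarrow> ell2 \<Rightarrow> ell2" is "\<lambda>r x i. r * x i"
  by (simp add: power_mult_distrib summable_mult)

lift_definition minus_ell2 :: "ell2 \<Rightarrow> ell2 \<Rightarrow> ell2" is "\<lambda>x y i. x i - y i"
  subgoal for x y using square_summable_add[of x "\<lambda>i. - y i"] by simp
  done

instance
  by intro_classes (transfer; simp add: fun_eq_iff algebra_simps)+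

end

instantiation ell2 :: real_inner
begin

definition inner_ell2 :: "ell2 \<Rightarrow> ell2 \<Rightarrow> real"
  where "inner_ell2 x y = (\<Sum>i. coord x i * coord y i)"

definition norm_ell2 :: "ell2 \<Rightarrow> real"
  where "norm_ell2 x = sqrt (\<Sum>i. (coord x i)\<^sup>2)"

definition sgn_ell2 :: "ell2 \<Rightarrow> ell2"
  where "sgn_ell2 x = inverse (norm x) *\<^sub>R x"

definition dist_ell2 :: "ell2 \<Rightarrow> ell2 \<Rightarrow> real"
  where "dist_ell2 x y = norm (x - y)"

definition uniformity_ell2 :: "(ell2 \<times> ell2) filter"
  where "uniformity_ell2 = (INF e\<in>{0<..}. principal {(x, y). dist x y < e})"

definition open_ell2 :: "ell2 set \<Rightarrow> bool"
  where "open_ell2 U \<longleftrightarrow> (\<forall>x\<in>U. \<forall>\<^sub>F (x', y) in uniformity. x' = x \<longrightarrow> y \<in> U)"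

instance
proof
  fix x y z :: ell2 and r :: real
  show "inner x y = inner y x"
    by (simp add: inner_ell2_def mult.commute)
  show "inner (x + y) z = inner x z + inner y z"
    by (simp add: inner_ell2_def plus_ell2.rep_eq distrib_right suminf_add summable_coord_mult)
  show "inner (r *\<^sub>R x) y = r * inner x y"
    by (simp add: inner_ell2_def scaleR_ell2.rep_eq mult.assoc suminf_mult summable_coord_mult)
  show "0 \<le> inner x x"
    unfolding inner_ell2_def by (intro suminf_nonneg summable_coord_mult) simp
  show "inner x x = 0 \<longleftrightarrow> x = 0"
  proof -
    have "inner x x = 0 \<longleftrightarrow> (\<forall>i. coord x i * coord x i = 0)"
      unfolding inner_ell2_def by (intro suminf_eq_zero_iff summable_coord_mult) simp
    also have "\<dots> \<longleftrightarrow> x = 0"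
      by (simp add: coord_inject[symmetric] zero_ell2.rep_eq fun_eq_iff)
    finally show ?thesis .
  qed
  show "norm x = sqrt (inner x x)"
    by (simp add: norm_ell2_def inner_ell2_def power2_eq_square)
qed (rule sgn_ell2_def dist_ell2_def uniformity_ell2_def open_ell2_def)+

end

lemmas coord_simps [simp] =
  zero_ell2.rep_eq plus_ell2.rep_eq uminus_ell2.rep_eq minus_ell2.rep_eq scaleR_ell2.rep_eq

lemma norm_ell2_square: "(norm (x :: ell2))\<^sup>2 = (\<Sum>i. (coord x i)\<^sup>2)"
  unfolding norm_ell2_def by (simp add: suminf_nonneg summable_coord_square)

lemma sum_coord_le_norm: "(\<Sum>i<n. (coord x i)\<^sup>2) \<le> (norm x)\<^sup>2"
  unfolding norm_ell2_square by (rule sum_le_suminf) (simp_all add: summable_coord_square)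

lemma abs_coord_le_norm: "\<bar>coord x i\<bar> \<le> norm x"
proof -
  have "(coord x i)\<^sup>2 \<le> (\<Sum>j<Suc i. (coord x j)\<^sup>2)"
    by (simp add: sum_nonneg)
  also have "\<dots> \<le> (norm x)\<^sup>2"
    by (rule sum_coord_le_norm)
  finally show ?thesis
    by (simp add: abs_le_square_iff[symmetric])
qed

instance ell2 :: complete_space
proof
  fix X :: "nat \<Rightarrow> ell2"
  assume X: "Cauchy X"
  have "Cauchy (\<lambda>n. coord (X n) i)" for i
  proof (rule metric_CauchyI)
    fix e :: real assume "0 < e"
    with X obtain M where M: "\<And>m n. m \<ge> M \<Longrightarrow> n \<ge> M \<Longrightarrow> dist (X m) (X n) < e"
      by (metis metric_CauchyD)
    have "dist (coord (X m) i) (coord (X n) i) < e" if "m \<ge> M" "n \<ge> M" for m n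
      using abs_coord_le_norm[of "X m - X n" i] M[OF that] by (simp add: dist_norm)
    then show "\<exists>M. \<forall>m\<ge>M. \<forall>n\<ge>M. dist (coord (X m) i) (coord (X n) i) < e" by blast
  qed
  then have "\<forall>i. \<exists>l. (\<lambda>n. coord (X n) i) \<longlonglongrightarrow> l"
    by (simp add: Cauchy_convergent_iff convergent_def)
  then obtain y where y: "\<And>i. (\<lambda>n. coord (X n) i) \<longlonglongrightarrow> y i" by metis
  have key: "\<exists>M. \<forall>n\<ge>M. \<forall>k. (\<Sum>i<k. (y i - coord (X n) i)\<^sup>2) \<le> e\<^sup>2" if "e > 0" for e
  proof -
    from X \<open>e > 0\<close> obtain M where M: "\<And>m n. m \<ge> M \<Longrightarrow> n \<ge> M \<Longrightarrow> dist (X m) (X n) < e"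
      by (metis metric_CauchyD)
    have "(\<Sum>i<k. (y i - coord (X n) i)\<^sup>2) \<le> e\<^sup>2" if n: "n \<ge> M" for n k
    proof (rule tendsto_upperbound)
      show "(\<lambda>m. \<Sum>i<k. (coord (X m) i - coord (X n) i)\<^sup>2)
          \<longlonglongrightarrow> (\<Sum>i<k. (y i - coord (X n) i)\<^sup>2)"
        by (intro tendsto_intros y)
      show "\<forall>\<^sub>F m in sequentially. (\<Sum>i<k. (coord (X m) i - coord (X n) i)\<^sup>2) \<le> e\<^sup>2"
        using eventually_ge_at_top[of M]
      proof eventually_elim
        case (elim m)
        have "(\<Sum>i<k. (coord (X m) i - coord (X n) i)\<^sup>2) \<le> (norm (X m - X n))\<^sup>2"
          using sum_coord_le_norm[of "X m - X n" k] by simp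
        also have "\<dots> \<le> e\<^sup>2"
          using M[OF elim n] by (intro power_mono) (simp_all add: dist_norm)
        finally show ?case .
      qed
    qed simp
    then show ?thesis by blast
  qed
  have diff: "summable (\<lambda>i. (y i - coord (X n) i)\<^sup>2)"
    if "\<forall>k. (\<Sum>i<k. (y i - coord (X n) i)\<^sup>2) \<le> e\<^sup>2" for n and e :: real
    using that by (intro summableI_nonneg_bounded[where x = "e\<^sup>2"]) auto
  obtain M1 where M1: "\<And>n k. n \<ge> M1 \<Longrightarrow> (\<Sum>i<k. (y i - coord (X n) i)\<^sup>2) \<le> 1\<^sup>2"
    using key[of 1] by auto
  have "summable (\<lambda>i. (y i)\<^sup>2)"
    using square_summable_add[OF diff[of M1 1] summable_coord_square[of "X M1"]] M1 by simp
  then have coordY: "coord (Abs_ell2 y) = y"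
    by (simp add: Abs_ell2_inverse)
  have "X \<longlonglongrightarrow> Abs_ell2 y"
  proof (rule metric_LIMSEQ_I)
    fix e :: real assume "0 < e"
    then obtain M where M: "\<And>n k. n \<ge> M \<Longrightarrow> (\<Sum>i<k. (y i - coord (X n) i)\<^sup>2) \<le> (e / 2)\<^sup>2"
      using key[of "e / 2"] by auto
    have "dist (X n) (Abs_ell2 y) < e" if "n \<ge> M" for n
    proof -
      have "(norm (Abs_ell2 y - X n))\<^sup>2 = (\<Sum>i. (y i - coord (X n) i)\<^sup>2)"
        by (simp add: norm_ell2_square coordY)
      also have "\<dots> \<le> (e / 2)\<^sup>2"
        using M[OF that] by (intro suminf_le_const diff[of n "e / 2"]) auto
      finally have "norm (Abs_ell2 y - X n) \<le> e / 2"
        using \<open>0 < e\<close> by (simp add: power2_le_iff_abs_le)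
      then show ?thesis
        using \<open>0 < e\<close> by (simp add: dist_norm norm_minus_commute)
    qed
    then show "\<exists>no. \<forall>n\<ge>no. dist (X n) (Abs_ell2 y) < e" by blast
  qed
  then show "convergent X" by (auto simp: convergent_def)
qed

definition rational_ell2 :: "rat list \<Rightarrow> ell2"
  where "rational_ell2 qs = Abs_ell2 (\<lambda>i. if i < length qs then of_rat (qs ! i) else 0)"

lemma coord_rational_ell2:
  "coord (rational_ell2 qs) = (\<lambda>i. if i < length qs then of_rat (qs ! i) else 0)"
  unfolding rational_ell2_def
proof (rule Abs_ell2_inverse, clarify)
  show "summable (\<lambda>i. (if i < length qs then of_rat (qs ! i) else 0 :: real)\<^sup>2)"
    by (rule summable_finite[of "{..<length qs}"]) auto
qed

lemma rational_ell2_dense: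
  assumes "0 < e"
  shows "\<exists>qs. dist (rational_ell2 qs) x < e"
proof -
  let ?f = "\<lambda>i. (coord x i)\<^sup>2"
  have "(\<lambda>n. \<Sum>i<n. ?f i) \<longlonglongrightarrow> (\<Sum>i. ?f i)"
    by (rule summable_LIMSEQ[OF summable_coord_square])
  moreover have "0 < e\<^sup>2 / 2" using assms by simp
  ultimately obtain n where "\<bar>(\<Sum>i<n. ?f i) - (\<Sum>i. ?f i)\<bar> < e\<^sup>2 / 2"
    using LIMSEQ_D[of "\<lambda>n. \<Sum>i<n. ?f i" "\<Sum>i. ?f i" "e\<^sup>2 / 2"] by auto
  moreover have split: "(\<Sum>i. ?f i) = (\<Sum>i. ?f (i + n)) + (\<Sum>i<n. ?f i)"
    by (rule suminf_split_initial_segment[OF summable_coord_square])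
  ultimately have tail: "(\<Sum>i. ?f (i + n)) < e\<^sup>2 / 2" by linarith
  define d where "d = e / sqrt (2 * real (Suc n))"
  have "0 < d" using assms by (simp add: d_def)
  have "\<forall>i. \<exists>q :: rat. \<bar>of_rat q - coord x i\<bar> < d"
  proof
    fix i
    obtain q where "coord x i < of_rat q" "of_rat q < coord x i + d"
      using of_rat_dense[of "coord x i" "coord x i + d"] \<open>0 < d\<close> by auto
    then have "\<bar>of_rat q - coord x i\<bar> < d" by linarith
    then show "\<exists>q :: rat. \<bar>of_rat q - coord x i\<bar> < d" ..
  qed
  then obtain q :: "nat \<Rightarrow> rat" where q: "\<And>i. \<bar>of_rat (q i) - coord x i\<bar> < d" by metis
  define z where "z = rational_ell2 (map q [0..<n])"
  have z: "coord z i = (if i < n then of_rat (q i) else 0)" for i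
    by (simp add: z_def coord_rational_ell2)
  have "(norm (z - x))\<^sup>2 = (\<Sum>i. (coord (z - x) (i + n))\<^sup>2) + (\<Sum>i<n. (coord (z - x) i)\<^sup>2)"
    unfolding norm_ell2_square
    by (rule suminf_split_initial_segment[OF summable_coord_square])
  also have "(\<Sum>i. (coord (z - x) (i + n))\<^sup>2) = (\<Sum>i. ?f (i + n))"
    by (simp add: z)
  also have "(\<Sum>i<n. (coord (z - x) i)\<^sup>2) \<le> (\<Sum>i<n. d\<^sup>2)"
  proof (rule sum_mono)
    fix i assume "i \<in> {..<n}"
    then have "\<bar>coord (z - x) i\<bar> \<le> d" using q[of i] by (simp add: z)
    then show "(coord (z - x) i)\<^sup>2 \<le> d\<^sup>2"
      using \<open>0 < d\<close> by (simp add: abs_le_square_iff[symmetric])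
  qed
  also have "(\<Sum>i<n. d\<^sup>2) \<le> e\<^sup>2 / 2"
  proof -
    have "d\<^sup>2 = e\<^sup>2 / (2 * real (Suc n))"
      by (simp add: d_def power_divide)
    then have "2 * d\<^sup>2 + real n * (2 * d\<^sup>2) = e\<^sup>2"
      by (simp add: field_simps)
    moreover have "0 \<le> d\<^sup>2" by simp
    ultimately have "real n * (2 * d\<^sup>2) \<le> e\<^sup>2" by linarith
    then show ?thesis by simp
  qed
  finally have "(norm (z - x))\<^sup>2 < e\<^sup>2" using tail by simp
  then have "dist z x < e"
    using assms by (simp add: dist_norm power2_less_imp_less)
  then show ?thesis unfolding z_def by blast
qed

instance ell2 :: second_countable_topology
proof
  define B where "B = (\<lambda>(qs, n). ball (rational_ell2 qs) (1 / real (Suc n))) ` UNIV"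
  have "topological_basis B"
  proof (rule topological_basisI)
    show "open b" if "b \<in> B" for b
      using that by (auto simp: B_def)
    fix U :: "ell2 set" and x assume "open U" "x \<in> U"
    then obtain e where e: "0 < e" "ball x e \<subseteq> U"
      by (metis openE)
    obtain n where n: "1 / real (Suc n) < e / 2"
      using nat_approx_posE[of "e / 2"] e by auto
    obtain qs where qs: "dist (rational_ell2 qs) x < 1 / real (Suc n)"
      using rational_ell2_dense[of "1 / real (Suc n)" x] by auto
    have "ball (rational_ell2 qs) (1 / real (Suc n)) \<subseteq> ball x e"
    proof
      fix w assume "w \<in> ball (rational_ell2 qs) (1 / real (Suc n))"
      then show "w \<in> ball x e"
        using qs n dist_triangle[of x w "rational_ell2 qs"] by (simp add: dist_commute)
    qed
    with e qs show "\<exists>b\<in>B. x \<in> b \<and> b \<subseteq> U"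
      unfolding B_def by (intro bexI[of _ "ball (rational_ell2 qs) (1 / real (Suc n))"]) auto
  qed
  moreover have "countable B" unfolding B_def by simp
  ultimately show "\<exists>B :: ell2 set set. countable B \<and> open = generate_topology B"
    by (metis topological_basis_imp_subbasis)
qed

instance ell2 :: polish_space ..


section \<open>Curves, one-dimensional Hausdorff measure, pure unrectifiability\<close>

text \<open>The norm on the type of bounded linear maps is the operator norm.\<close>

definition C1_curve :: "(real \<Rightarrow> 'a::real_normed_vector) \<Rightarrow> bool"
  where "C1_curve f \<longleftrightarrow>
    (\<exists>A :: real \<Rightarrow> real \<Rightarrow>\<^sub>L 'a.
      (\<forall>x\<in>{0..1}. (f has_derivative blinfun_apply (A x)) (at x within {0..1})) \<and>
      continuous_on {0..1} A)"

text \<open>Boundedness of the covering sets is required since \<^const>\<open>diameter\<close> is real-valued and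
  meaningless on unbounded sets.\<close>

definition hausdorff1_size :: "real \<Rightarrow> 'a::metric_space set \<Rightarrow> ennreal"
  where "hausdorff1_size \<delta> E =
    (INF C\<in>{C :: nat \<Rightarrow> 'a set. E \<subseteq> (\<Union>i. C i) \<and> (\<forall>i. bounded (C i) \<and> diameter (C i) \<le> \<delta>)}.
      \<Sum>i. ennreal (diameter (C i)))"

definition hausdorff1 :: "'a::metric_space set \<Rightarrow> ennreal"
  where "hausdorff1 E = (SUP \<delta>\<in>{0<..}. hausdorff1_size \<delta> E)"

definition purely_unrectifiable :: "'a::real_normed_vector set \<Rightarrow> bool"
  where "purely_unrectifiable N \<longleftrightarrow>
    (\<forall>f :: real \<Rightarrow> 'a. C1_curve f \<longrightarrow> hausdorff1 (N \<inter> f ` {0..1}) = 0)"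


section \<open>Polish spaces and the first projective level\<close>

definition polish_topology :: "'a topology \<Rightarrow> bool"
  where "polish_topology X \<longleftrightarrow> completely_metrizable_space X \<and> separable_space X"

definition borel_of :: "'a topology \<Rightarrow> 'a measure"
  where "borel_of X = sigma (topspace X) {U. openin X U}"

text \<open>HOL cannot quantify over types inside a definition, so the auxiliary Polish space \<open>Y\<close> has a
  subset of \<^typ>\<open>nat \<Rightarrow> real\<close> as its set of points, with an arbitrary topology. This is no
  restriction: see \<open>polish_topology_copy\<close> below.\<close>

definition sigma11 :: "'a topology \<Rightarrow> 'a set \<Rightarrow> bool"
  where "sigma11 X A \<longleftrightarrow>
    (\<exists>(Y :: (nat \<Rightarrow> real) topology) B.
      polish_topology Y \<and> B \<in> sets (borel_of (prod_topology X Y)) \<and> A = fst ` B)"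

definition pi11 :: "'a topology \<Rightarrow> 'a set \<Rightarrow> bool"
  where "pi11 X A \<longleftrightarrow> A \<subseteq> topspace X \<and> sigma11 X (topspace X - A)"

definition borel_wadge_reducible ::
    "'a topology \<Rightarrow> 'a set \<Rightarrow> 'b topology \<Rightarrow> 'b set \<Rightarrow> bool"
  where "borel_wadge_reducible X A Y B \<longleftrightarrow>
    (\<exists>f \<in> borel_of X \<rightarrow>\<^sub>M borel_of Y. \<forall>x\<in>topspace X. x \<in> A \<longleftrightarrow> f x \<in> B)"

text \<open>The type argument carries the points of the Polish spaces that are reduced to \<open>A\<close>. With a type
  variable in its place, a theorem covers Polish spaces of every type.\<close>

definition pi11_hard :: "'b itself \<Rightarrow> 'a topology \<Rightarrow> 'a set \<Rightarrow> bool"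
  where "pi11_hard _ X A \<longleftrightarrow>
    (\<forall>(Z :: 'b topology) B. polish_topology Z \<longrightarrow> pi11 Z B \<longrightarrow> borel_wadge_reducible Z B X A)"

definition pi11_complete :: "'b itself \<Rightarrow> 'a topology \<Rightarrow> 'a set \<Rightarrow> bool"
  where "pi11_complete TB X A \<longleftrightarrow> pi11 X A \<and> pi11_hard TB X A"


section \<open>The Effros Borel space of closed subsets\<close>

definition effros :: "'a::metric_space set measure"
  where "effros = sigma {A. closed A} {{A. closed A \<and> A \<inter> ball x r \<noteq> {}} | x r. 0 < r}"

definition effros_polish_topology :: "'a::metric_space set topology \<Rightarrow> bool"
  where "effros_polish_topology T \<longleftrightarrow>
    polish_topology T \<and> topspace T = {A. closed A} \<and> sets (borel_of T) = sets effros"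


section \<open>Adequacy of the encodings\<close>

lemma space_borel_of [simp]: "space (borel_of X) = topspace X"
  by (simp add: borel_of_def space_measure_of_conv)

lemma sets_borel_of: "sets (borel_of X) = sigma_sets (topspace X) {U. openin X U}"
  unfolding borel_of_def by (rule sets_measure_of) (auto dest: openin_subset)

lemma homeomorphic_polish_topology:
  assumes "X homeomorphic_space Y"
  shows "polish_topology X \<longleftrightarrow> polish_topology Y"
  using assms homeomorphic_completely_metrizable_space homeomorphic_separable_space
  unfolding polish_topology_def by blast

lemma pullback_homeomorphic:
  assumes "inj_on f S"
  shows "pullback_topology S f X homeomorphic_space subtopology X (f ` S)"
proof -
  have "homeomorphic_map (pullback_topology S f X) (subtopology X (f ` S)) f"
  proof (rule bijective_open_imp_homeomorphic_map)
    show "continuous_map (pullback_topology S f X) (subtopology X (f ` S)) f"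
      unfolding continuous_map_in_subtopology
    proof
      show "continuous_map (pullback_topology S f X) X f"
        unfolding continuous_map_def
      proof (intro conjI allI impI)
        show "f \<in> topspace (pullback_topology S f X) \<rightarrow> topspace X"
          by (auto simp: topspace_pullback_topology)
        fix V assume V: "openin X V"
        have "{x \<in> topspace (pullback_topology S f X). f x \<in> V} = f -` V \<inter> S"
          using openin_subset[OF V] by (auto simp: topspace_pullback_topology)
        with V show "openin (pullback_topology S f X)
            {x \<in> topspace (pullback_topology S f X). f x \<in> V}"
          unfolding openin_pullback_topology by blast
      qed
      show "f \<in> topspace (pullback_topology S f X) \<rightarrow> f ` S"
        by (auto simp: topspace_pullback_topology)
    qed
    show "open_map (pullback_topology S f X) (subtopology X (f ` S)) f"
      unfolding open_map_def openin_pullback_topology openin_subtopology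
    proof (intro allI impI, elim exE conjE)
      fix W V assume "openin X V" "W = f -` V \<inter> S"
      moreover from this have "f ` W = V \<inter> f ` S" by auto
      ultimately show "\<exists>V. openin X V \<and> f ` W = V \<inter> f ` S" by blast
    qed
    show "f ` topspace (pullback_topology S f X) = topspace (subtopology X (f ` S))"
      by (auto simp: topspace_pullback_topology)
    show "inj_on f (topspace (pullback_topology S f X))"
      using assms by (auto simp: topspace_pullback_topology inj_on_def)
  qed
  then show ?thesis
    by (rule homeomorphic_map_imp_homeomorphic_space)
qed

lemma polish_topology_copy:
  assumes "polish_topology X"
  shows "\<exists>Y :: (nat \<Rightarrow> real) topology. polish_topology Y \<and> X homeomorphic_space Y"
proof -
  obtain M d where M: "Metric_space M d" and X: "X = Metric_space.mtopology M d"
    using assms unfolding polish_topology_def completely_metrizable_space_def by blast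
  interpret Metric_space M d by (rule M)
  obtain C where C: "countable C" "C \<subseteq> M" "mtopology closure_of C = M"
    using assms unfolding polish_topology_def separable_space_def X by auto
  define g where "g x = (\<lambda>n. d x (from_nat_into C n))" for x
  have inj: "inj_on g M"
  proof (rule inj_onI)
    fix x y assume xy: "x \<in> M" "y \<in> M" "g x = g y"
    show "x = y"
    proof (rule ccontr)
      assume "x \<noteq> y"
      with xy have pos: "0 < d x y / 2" by simp
      have "x \<in> mtopology closure_of C" using C xy by simp
      then obtain c where c: "c \<in> C" "c \<in> mball x (d x y / 2)"
        using pos unfolding metric_closure_of by blast
      then have "d x c = d y c"
        using xy(3) from_nat_into_to_nat_on[OF C(1) c(1)] unfolding g_def by metis
      moreover have "d x y \<le> d x c + d c y"
        using xy c C by (intro triangle) auto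
      ultimately show False
        using c(2) by (simp add: commute)
    qed
  qed
  define Y where "Y = pullback_topology (g ` M) (inv_into M g) X"
  have "Y homeomorphic_space subtopology X (inv_into M g ` g ` M)"
    unfolding Y_def by (intro pullback_homeomorphic inj_on_inv_into) auto
  also have "inv_into M g ` g ` M = topspace X"
    using inj by (simp add: X)
  finally have "Y homeomorphic_space X" by simp
  then have "X homeomorphic_space Y"
    using homeomorphic_space_sym by blast
  then show ?thesis
    using assms homeomorphic_polish_topology by blast
qed

lemma second_countable_euclidean:
  "second_countable (euclidean :: 'a::second_countable_topology topology)"
proof -
  obtain B :: "'a set set" where B: "countable B" "topological_basis B"
    using ex_countable_basis by blast
  then show ?thesis
    unfolding second_countable_def
    by (metis open_openin topological_basisE topological_basis_open)
qed

lemma effros_open: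
  fixes U :: "'a::{metric_space, second_countable_topology} set"
  assumes "open U"
  shows "{A. closed A \<and> A \<inter> U \<noteq> {}} \<in> sets effros"
proof -
  define F where "F = {ball x r | x r :: real. 0 < r \<and> ball x r \<subseteq> U}"
  have UF: "U = \<Union>F"
  proof
    show "U \<subseteq> \<Union>F"
    proof
      fix x assume "x \<in> U"
      with assms obtain r where "0 < r" "ball x r \<subseteq> U" by (metis openE)
      then show "x \<in> \<Union>F" unfolding F_def by (auto intro!: exI[of _ "ball x r"])
    qed
  qed (auto simp: F_def)
  obtain F' where F': "F' \<subseteq> F" "countable F'" "\<Union>F' = \<Union>F"
    using Lindelof[of F] by (auto simp: F_def)
  have "{A. closed A \<and> A \<inter> U \<noteq> {}} = (\<Union>V\<in>F'. {A. closed A \<and> A \<inter> V \<noteq> {}})"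
    using UF F' by blast
  also have "\<dots> \<in> sets effros"
  proof (rule sets.countable_UN''[OF F'(2)])
    show "{A. closed A \<and> A \<inter> V \<noteq> {}} \<in> sets effros" if "V \<in> F'" for V
    proof -
      have "V \<in> F" using that F'(1) by blast
      then obtain x and r :: real where "V = ball x r" "0 < r" unfolding F_def by blast
      then show ?thesis
        unfolding effros_def by (subst sets_measure_of) (auto intro!: sigma_sets.Basic)
    qed
  qed
  finally show ?thesis .
qed

lemma space_effros [simp]: "space effros = {A. closed A}"
  by (simp add: effros_def space_measure_of_conv)

text \<open>The Effros Borel space of a Polish space is standard: the map sending a closed set to the
  indicator of the basic open sets it meets is injective, with a \<open>G\<^sub>\<delta>\<close> range.\<close>

lemma effros_polish_topology_exists:
  "\<exists>T :: 'a::polish_space set topology. effros_polish_topology T"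
proof -
  obtain B :: "'a set set" where B: "countable B" "topological_basis B"
    using ex_countable_basis by blast
  have "B \<noteq> {}"
    using topological_basisE[OF B(2) open_UNIV] by blast
  define U where "U = from_nat_into B"
  have rU: "range U = B"
    unfolding U_def by (rule range_from_nat_into[OF \<open>B \<noteq> {}\<close> B(1)])
  have openU: "open (U n)" for n
    using rU B(2) topological_basis_open by blast
  have basis: "\<exists>n. x \<in> U n \<and> U n \<subseteq> V" if "open V" "x \<in> V" for x V
    using topological_basisE[OF B(2) that] rU by (metis imageE)
  define \<phi> :: "'a set \<Rightarrow> nat \<Rightarrow> real" where "\<phi> A n = (if A \<inter> U n \<noteq> {} then 1 else 0)" for A n
  define F where "F = {A :: 'a set. closed A}"
  define N where "N n k = {m. U m \<noteq> {} \<and> closure (U m) \<subseteq> U n \<and>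
      (\<forall>x\<in>closure (U m). \<forall>y\<in>closure (U m). dist x y \<le> 1 / real (Suc k))}" for n k
  define S1 where "S1 = {s :: nat \<Rightarrow> real. (\<forall>n. s n = 0 \<or> s n = 1) \<and>
      (\<forall>n m. U n \<subseteq> U m \<longrightarrow> s n \<le> s m)}"
  define G where "G n k = {s :: nat \<Rightarrow> real. s n < 1} \<union> (\<Union>m\<in>N n k. {s. 0 < s m})" for n k
  define S where "S = S1 \<inter> (\<Inter>p. G (fst p) (snd p))"
  have inj: "inj_on \<phi> F"
  proof (rule inj_onI)
    have sub: "A \<subseteq> A'" if "A' \<in> F" "\<phi> A = \<phi> A'" for A A'
    proof
      fix x assume "x \<in> A"
      show "x \<in> A'"
      proof (rule ccontr)
        assume "x \<notin> A'"
        with that obtain n where n: "x \<in> U n" "U n \<subseteq> - A'"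
          using basis[of "- A'" x] by (auto simp: F_def)
        then have "\<phi> A n = 1" "\<phi> A' n = 0"
          using \<open>x \<in> A\<close> by (auto simp: \<phi>_def)
        then show False using that by simp
      qed
    qed
    show "A = A'" if "A \<in> F" "A' \<in> F" "\<phi> A = \<phi> A'" for A A'
      using sub that by (metis subset_antisym)
  qed
  have range: "\<phi> ` F = S"
  proof
    show "\<phi> ` F \<subseteq> S"
    proof
      fix s assume "s \<in> \<phi> ` F"
      then obtain A where A: "closed A" and s: "s = \<phi> A" by (auto simp: F_def)
      have "\<phi> A \<in> S1" by (auto simp: S1_def \<phi>_def)
      moreover have "\<phi> A \<in> G n k" for n k
      proof (cases "A \<inter> U n = {}")
        case True
        then show ?thesis by (simp add: G_def \<phi>_def)
      next
        case False
        then obtain x where x: "x \<in> A" "x \<in> U n" by blast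
        obtain r where r: "0 < r" "cball x r \<subseteq> U n"
          using open_contains_cball openU x(2) by blast
        define q where "q = min r (1 / (2 * real (Suc k)))"
        have "0 < q" using r by (simp add: q_def)
        then obtain m where m: "x \<in> U m" "U m \<subseteq> ball x q"
          using basis[of "ball x q" x] by auto
        have "closure (U m) \<subseteq> cball x q"
          using m(2) closure_minimal[of "U m" "cball x q"] ball_subset_cball by (metis closed_cball subset_trans)
        moreover have "cball x q \<subseteq> U n"
          using r by (auto simp: q_def)
        moreover have "dist a b \<le> 1 / real (Suc k)" if "a \<in> cball x q" "b \<in> cball x q" for a b
        proof -
          have "dist a b \<le> q + q"
            using that dist_triangle[of a b x] by (simp add: dist_commute)
          also have "\<dots> \<le> 1 / real (Suc k)"
          proof -
            have "q \<le> 1 / (2 * real (Suc k))" by (simp add: q_def)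
            then show ?thesis by (simp add: field_simps)
          qed
          finally show ?thesis .
        qed
        ultimately have "m \<in> N n k"
          using m(1) unfolding N_def by blast
        moreover have "0 < \<phi> A m"
          using m x by (auto simp: \<phi>_def)
        ultimately show ?thesis by (auto simp: G_def)
      qed
      ultimately show "s \<in> S" by (simp add: S_def s)
    qed
    show "S \<subseteq> \<phi> ` F"
    proof
      fix s assume s: "s \<in> S"
      have s01: "s n = 0 \<or> s n = 1" for n
        using s unfolding S_def S1_def by blast
      have smono: "s m = 1" if "U n \<subseteq> U m" "s n = 1" for n m
      proof -
        have "s \<in> S1" using s unfolding S_def by blast
        then have "s n \<le> s m" using that(1) unfolding S1_def by blast
        then show ?thesis using that(2) s01[of m] by auto
      qed
      have step: "\<exists>m\<in>N n k. s m = 1" if "s n = 1" for n k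
      proof -
        have "s \<in> G (fst (n, k)) (snd (n, k))" using s unfolding S_def by blast
        then have "s \<in> G n k" by simp
        with that obtain m where "m \<in> N n k" "0 < s m" by (auto simp: G_def)
        with s01[of m] show ?thesis by auto
      qed
      define A where "A = {x. \<forall>n. x \<in> U n \<longrightarrow> s n = 1}"
      have "A = - (\<Union>n\<in>{n. s n \<noteq> 1}. U n)" by (auto simp: A_def)
      then have "closed A" using openU by (auto intro!: closed_Compl)
      moreover have "A \<inter> U n \<noteq> {}" if n: "s n = 1" for n
      proof -
        obtain h where h: "\<And>n k. s n = 1 \<Longrightarrow> h n k \<in> N n k \<and> s (h n k) = 1"
          using step by metis
        define c where "c = rec_nat n (\<lambda>k p. h p k)"
        have c0: "c 0 = n" and cS: "c (Suc k) = h (c k) k" for k by (simp_all add: c_def)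
        have sc: "s (c k) = 1" for k
          by (induction k) (simp_all add: c0 cS n h)
        have cN: "c (Suc k) \<in> N (c k) k" for k
          using h[OF sc[of k]] by (simp add: cS)
        have dec: "closure (U (c (Suc (Suc k)))) \<subseteq> closure (U (c (Suc k)))" for k
          using cN[of "Suc k"] closure_subset by (auto simp: N_def)
        have "\<exists>a. \<forall>k. a \<in> closure (U (c (Suc k)))"
        proof (rule decreasing_closed_nest)
          show "closed (closure (U (c (Suc k))))" for k by simp
          show "closure (U (c (Suc k))) \<noteq> {}" for k
            using cN[of k] by (simp add: N_def)
          show "closure (U (c (Suc l))) \<subseteq> closure (U (c (Suc k)))" if "k \<le> l" for k l
            using that by (rule lift_Suc_antimono_le[of "\<lambda>k. closure (U (c (Suc k)))", OF dec])
          show "\<exists>k. \<forall>x\<in>closure (U (c (Suc k))). \<forall>y\<in>closure (U (c (Suc k))). dist x y < e"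
            if e: "0 < e" for e
          proof -
            obtain k where "1 / real (Suc k) < e" using nat_approx_posE[OF e] by metis
            then show ?thesis
              using cN[of k] unfolding N_def by (intro exI[of _ k]) force
          qed
        qed blast
        then obtain a where a: "\<And>k. a \<in> closure (U (c (Suc k)))" by blast
        have "a \<in> U n"
          using a[of 0] cN[of 0] by (auto simp: N_def c0)
        moreover have "a \<in> A"
          unfolding A_def
        proof (intro CollectI allI impI)
          fix j assume "a \<in> U j"
          then obtain e where e: "0 < e" "ball a e \<subseteq> U j" using openU by (metis openE)
          obtain k where k: "1 / real (Suc k) < e" using nat_approx_posE[OF e(1)] by metis
          have "U (c (Suc k)) \<subseteq> ball a e"
          proof
            fix y assume "y \<in> U (c (Suc k))"
            then have "y \<in> closure (U (c (Suc k)))" using closure_subset by blast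
            then have "dist a y \<le> 1 / real (Suc k)"
              using cN[of k] a[of k] by (simp add: N_def)
            then show "y \<in> ball a e" using k by simp
          qed
          with e have "U (c (Suc k)) \<subseteq> U j" by blast
          then show "s j = 1" using smono sc by blast
        qed
        ultimately show ?thesis by blast
      qed
      moreover have "s n = 1" if "A \<inter> U n \<noteq> {}" for n
        using that by (auto simp: A_def)
      ultimately have "\<phi> A = s" "A \<in> F"
        using s01 by (force simp: \<phi>_def F_def fun_eq_iff)+
      then show "s \<in> \<phi> ` F" by blast
    qed
  qed
  have "S1 = (\<Inter>n. {s. s n = 0} \<union> {s. s n = 1}) \<inter>
      (\<Inter>n. \<Inter>m\<in>{m. U n \<subseteq> U m}. {s. s n \<le> s m})"
    unfolding S1_def by blast
  also have "closed \<dots>"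
    by (intro closed_Int closed_INT closed_Un ballI closed_Collect_eq closed_Collect_le
        continuous_on_const continuous_on_product_coordinates)
  finally have "closed S1" .
  have "open (G n k)" for n k
    unfolding G_def
    by (intro open_Un open_UN ballI open_Collect_less continuous_on_const
        continuous_on_product_coordinates)
  have cm: "completely_metrizable_space (euclidean :: (nat \<Rightarrow> real) topology)"
    by (rule completely_metrizable_space_euclidean)
  have "gdelta_in euclidean S1"
    using \<open>closed S1\<close> cm closed_imp_gdelta_in[of euclidean S1]
      completely_metrizable_imp_metrizable_space by auto
  moreover have "gdelta_in euclidean (\<Inter>p. G (fst p) (snd p))"
    using \<open>\<And>n k. open (G n k)\<close> by (intro gdelta_in_Inter) (auto intro: open_imp_gdelta_in)
  ultimately have "gdelta_in euclidean S"
    unfolding S_def by (rule gdelta_in_Int)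
  then have "completely_metrizable_space (subtopology euclidean S)"
    by (rule completely_metrizable_space_gdelta_in[OF cm])
  moreover have "separable_space (subtopology euclidean S)"
    by (intro second_countable_imp_separable_space second_countable_subtopology
        second_countable_euclidean)
  ultimately have "polish_topology (subtopology euclidean S)"
    by (simp add: polish_topology_def)
  define T where "T = pullback_topology F \<phi> euclidean"
  have "T homeomorphic_space subtopology euclidean S"
    unfolding T_def range[symmetric] by (rule pullback_homeomorphic[OF inj])
  with \<open>polish_topology (subtopology euclidean S)\<close> have "polish_topology T"
    using homeomorphic_polish_topology by blast
  moreover have topT: "topspace T = {A. closed A}"
    by (simp add: T_def topspace_pullback_topology F_def)
  moreover have "sets (borel_of T) = sets effros"
  proof
    have meas: "\<phi> \<in> borel_measurable effros"
    proof (rule measurable_coordinatewise_then_product)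
      fix n
      have "(\<lambda>A. \<phi> A n) \<in> borel_measurable effros \<longleftrightarrow>
          (\<lambda>A. indicator {A. closed A \<and> A \<inter> U n \<noteq> {}} A :: real) \<in> borel_measurable effros"
        by (rule measurable_cong) (simp add: \<phi>_def)
      then show "(\<lambda>A. \<phi> A n) \<in> borel_measurable effros"
        using effros_open[OF openU] by (simp add: borel_measurable_indicator)
    qed
    have "W \<in> sets effros" if "openin T W" for W
    proof -
      obtain V where "open V" "W = \<phi> -` V \<inter> space effros"
        using \<open>openin T W\<close> by (auto simp: T_def openin_pullback_topology F_def)
      then show ?thesis using measurable_sets[OF meas] by simp
    qed
    then show "sets (borel_of T) \<subseteq> sets effros"
      unfolding sets_borel_of topT using sets.sigma_sets_subset[of "{U. openin T U}" effros] by auto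
    have "{A. closed A \<and> A \<inter> ball x r \<noteq> {}} \<in> sets (borel_of T)" for x :: 'a and r
    proof -
      define I where "I = {n. U n \<subseteq> ball x r}"
      have "openin T {A. closed A \<and> A \<inter> ball x r \<noteq> {}}"
        unfolding T_def openin_pullback_topology
      proof (intro exI conjI)
        show "openin euclidean (\<Union>n\<in>I. {s :: nat \<Rightarrow> real. 0 < s n})"
          unfolding open_openin[symmetric]
          by (intro open_UN ballI open_Collect_less continuous_on_const
              continuous_on_product_coordinates)
        have hit: "A \<inter> ball x r \<noteq> {} \<longleftrightarrow> (\<exists>n\<in>I. A \<inter> U n \<noteq> {})" for A
          using basis[OF open_ball[of x r]] unfolding I_def by blast
        have pos: "0 < \<phi> A n \<longleftrightarrow> A \<inter> U n \<noteq> {}" for A n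
          by (simp add: \<phi>_def)
        show "{A. closed A \<and> A \<inter> ball x r \<noteq> {}}
            = \<phi> -` (\<Union>n\<in>I. {s. 0 < s n}) \<inter> F"
        proof (rule set_eqI)
          fix A
          show "A \<in> {A. closed A \<and> A \<inter> ball x r \<noteq> {}} \<longleftrightarrow>
              A \<in> \<phi> -` (\<Union>n\<in>I. {s. 0 < s n}) \<inter> F"
            unfolding F_def Int_iff[of _ _ "Collect _"] vimage_eq UN_iff mem_Collect_eq hit pos
            by (rule conj_commute)
        qed
      qed
      then show ?thesis unfolding sets_borel_of by (auto intro: sigma_sets.Basic)
    qed
    then show "sets effros \<subseteq> sets (borel_of T)"
      using sets.sigma_sets_subset[of "{{A. closed A \<and> A \<inter> ball x r \<noteq> {}} | x r. 0 < r}" "borel_of T"]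
      unfolding effros_def by (subst sets_measure_of) (auto simp: topT)
  qed
  ultimately show ?thesis
    unfolding effros_polish_topology_def by blast
qed

end

theory Submission
  imports Defs
begin

text \<open>Completeness has two halves, which rest on different ideas.

  For the upper bound, a closed set \<open>A\<close> is not purely unrectifiable exactly if there is a continuously
  differentiable curve whose range meets it in positive measure. Such curves are coded by the values of
  the curve and of its derivative at rational times, and being a code is a Borel condition
  (\<open>C1_code_curve\<close>, \<open>C1_curve_code\<close>, \<open>C1_code_borel\<close>). Since the range \<open>K\<close> is compact, the vanishing of the measure of
  \<open>A \<inter> K\<close> is witnessed, for each bound on the total size, by finitely many balls covering \<open>A \<inter> K\<close>
  together with finitely many balls that cover the rest of \<open>K\<close> and stay away from \<open>A\<close>
  (\<open>hausdorff1_closed_Int_compact_eq_0_iff\<close>). With rational data there are countably many such witnesses, and each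
  imposes separate Borel conditions on \<open>A\<close> and on the code. So the complement is a projection of a
  Borel set. This half works in every separable complete normed space.

  For hardness, a coanalytic set is first brought into the form of all \<open>z\<close> for which a tree \<open>T z\<close> of finite
  sequences of natural numbers has no infinite branch, where each condition \<open>s \<in> T z\<close> is Borel in \<open>z\<close>
  (\<open>coanalytic_well_founded_trees\<close>). This uses that Borel sets in a product with a Polish space come from rectangles
  by the Suslin operation and that completeness allows the Polish factor to be projected away
  (\<open>projection_borel_suslin\<close>). In the Hilbert space, every node of a tree is then given finitely many points: a net
  of a unit segment, which gets finer with the level of the node. The segments converge along
  infinite branches, and points that belong to different subtrees are kept apart by orthogonality. If
  the tree has a branch, the closure of all these points contains a whole segment; if it has none, the
  points have no further limit and the set is closed and countable
  (\<open>tree_points_purely_unrectifiable_iff\<close>). Only the countably many points have to be tested against an open set, so the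
  closure depends on \<open>z\<close> in a Borel way.\<close>

section \<open>The Suslin operation\<close>

abbreviation initial :: "(nat \<Rightarrow> nat) \<Rightarrow> nat \<Rightarrow> nat list"
  where "initial \<alpha> n \<equiv> map \<alpha> [0..<n]"

text \<open>A family of sets indexed by finite sequences is a countable object, while the witnesses
  \<open>\<alpha>\<close> range over all infinite sequences. This lets the operation express projections.\<close>

definition suslin :: "'a set set \<Rightarrow> 'a set set"
  where "suslin P =
    {E. \<exists>R :: nat list \<Rightarrow> 'a set. range R \<subseteq> P \<and> E = {w. \<exists>\<alpha>. \<forall>n. w \<in> R (initial \<alpha> n)}}"

lemma suslinI:
  assumes "\<And>s. R s \<in> P" "\<And>w. w \<in> E \<longleftrightarrow> (\<exists>\<alpha>. \<forall>n. w \<in> R (initial \<alpha> n))"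
  shows "E \<in> suslin P"
  using assms unfolding suslin_def by (intro CollectI exI[of _ R]) blast

lemma suslinE:
  assumes "E \<in> suslin P"
  obtains R where "\<And>s. R s \<in> P" "\<And>w. w \<in> E \<longleftrightarrow> (\<exists>\<alpha>. \<forall>n. w \<in> R (initial \<alpha> n))"
  using assms unfolding suslin_def by blast

lemma suslin_familyE:
  assumes "\<And>m. E m \<in> suslin P"
  obtains R where "\<And>m s. R m s \<in> P"
    "\<And>m w. w \<in> E m \<longleftrightarrow> (\<exists>\<alpha>. \<forall>n. w \<in> R m (initial \<alpha> n))"
proof -
  have "\<forall>m. \<exists>R. range R \<subseteq> P \<and> E m = {w. \<exists>\<alpha>. \<forall>n. w \<in> R (initial \<alpha> n)}"
    using assms by (simp add: suslin_def)
  from choice[OF this] obtain R where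
    R: "\<forall>m. range (R m) \<subseteq> P \<and> E m = {w. \<exists>\<alpha>. \<forall>n. w \<in> R m (initial \<alpha> n)}" ..
  then show thesis by (intro that[of R]) auto
qed

lemma suslin_base: "A \<in> P \<Longrightarrow> A \<in> suslin P"
  by (rule suslinI[of "\<lambda>_. A"]) auto

lemma initial_Suc_Cons: "initial \<alpha> (Suc n) = \<alpha> 0 # initial (\<lambda>i. \<alpha> (Suc i)) n"
  by (simp add: upt_conv_Cons map_Suc_upt[symmetric] comp_def del: upt_Suc)

text \<open>The first entry of the witness names the member of the union. The empty sequence then carries no
  information, so its set has to be the whole space.\<close>

lemma suslin_UN:
  assumes \<Omega>: "\<Omega> \<in> P" "\<And>A. A \<in> P \<Longrightarrow> A \<subseteq> \<Omega>"
    and E: "\<And>m :: nat. E m \<in> suslin P"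
  shows "(\<Union>m. E m) \<in> suslin P"
proof -
  obtain R where R: "\<And>m s. R m s \<in> P"
      "\<And>m w. w \<in> E m \<longleftrightarrow> (\<exists>\<alpha>. \<forall>n. w \<in> R m (initial \<alpha> n))"
    using suslin_familyE[of E, OF E] by blast
  define R' where "R' s = (case s of [] \<Rightarrow> \<Omega> | m # t \<Rightarrow> R m t)" for s
  show ?thesis
  proof (rule suslinI)
    show "R' s \<in> P" for s using R(1) \<Omega>(1) by (cases s) (simp_all add: R'_def)
    fix w
    have "(\<exists>m. w \<in> E m) \<longleftrightarrow> (\<exists>m \<alpha>. \<forall>n. w \<in> R' (m # initial \<alpha> n))"
      by (simp add: R(2) R'_def)
    also have "\<dots> \<longleftrightarrow> (\<exists>\<alpha>. \<forall>n. w \<in> R' (initial \<alpha> (Suc n)))"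
    proof
      assume "\<exists>m \<alpha>. \<forall>n. w \<in> R' (m # initial \<alpha> n)"
      then obtain m \<alpha> where "\<forall>n. w \<in> R' (m # initial \<alpha> n)" by blast
      then show "\<exists>\<alpha>. \<forall>n. w \<in> R' (initial \<alpha> (Suc n))"
        by (intro exI[of _ "case_nat m \<alpha>"]) (simp add: initial_Suc_Cons del: upt_Suc)
    qed (force simp: initial_Suc_Cons simp del: upt_Suc)
    also have "\<dots> \<longleftrightarrow> (\<exists>\<alpha>. \<forall>n. w \<in> R' (initial \<alpha> n))"
    proof -
      have "R' (initial \<alpha> (Suc 0)) \<subseteq> R' (initial \<alpha> 0)" for \<alpha>
        using R(1) \<Omega>(2) by (simp add: R'_def)
      then show ?thesis by (metis not0_implies_Suc subset_eq)
    qed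
    finally show "w \<in> (\<Union>m. E m) \<longleftrightarrow> (\<exists>\<alpha>. \<forall>n. w \<in> R' (initial \<alpha> n))" by simp
  qed
qed

text \<open>Countably many witnesses \<open>\<alpha>\<^sub>0, \<alpha>\<^sub>1, \<dots>\<close> are merged into one sequence by a pairing function. The
  pairing is strictly increasing in its second argument, so the first \<open>\<langle>m, n\<rangle>\<close> entries of the merged
  sequence determine the first \<open>n\<close> entries of \<open>\<alpha>\<^sub>m\<close>.\<close>

lemma suslin_INT:
  assumes E: "\<And>m :: nat. E m \<in> suslin P"
  shows "(\<Inter>m. E m) \<in> suslin P"
proof -
  obtain R where R: "\<And>m s. R m s \<in> P"
      "\<And>m w. w \<in> E m \<longleftrightarrow> (\<exists>\<alpha>. \<forall>n. w \<in> R m (initial \<alpha> n))"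
    using suslin_familyE[of E, OF E] by blast
  define R' where "R' s = (case prod_decode (length s) of
      (m, n) \<Rightarrow> R m (map (\<lambda>i. s ! prod_encode (m, i)) [0..<n]))" for s
  show ?thesis
  proof (rule suslinI)
    show "R' s \<in> P" for s using R(1) by (simp add: R'_def split: prod.split)
    fix w
    have mono: "prod_encode (m, i) < prod_encode (m, n)" if "i < n" for m i n
    proof -
      have "strict_mono (\<lambda>i. prod_encode (m, i))"
        by (rule strict_monoI_Suc) (simp add: prod_encode_def)
      then show ?thesis using that by (simp add: strict_mono_def)
    qed
    have R'_eq: "R' (initial \<beta> (prod_encode (m, n))) = R m (initial (\<lambda>i. \<beta> (prod_encode (m, i))) n)"
      for \<beta> m n
      using mono by (auto simp: R'_def intro!: arg_cong[where f = "R m"])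
    have "(\<forall>m. \<exists>\<alpha>. \<forall>n. w \<in> R m (initial \<alpha> n)) \<longleftrightarrow>
        (\<exists>\<beta>. \<forall>m n. w \<in> R m (initial (\<lambda>i. \<beta> (prod_encode (m, i))) n))"
    proof
      assume "\<forall>m. \<exists>\<alpha>. \<forall>n. w \<in> R m (initial \<alpha> n)"
      then obtain \<alpha> where "\<And>m n. w \<in> R m (initial (\<alpha> m) n)" by metis
      then show "\<exists>\<beta>. \<forall>m n. w \<in> R m (initial (\<lambda>i. \<beta> (prod_encode (m, i))) n)"
        by (intro exI[of _ "\<lambda>k. case prod_decode k of (m, i) \<Rightarrow> \<alpha> m i"]) simp
    qed blast
    also have "\<dots> \<longleftrightarrow> (\<exists>\<beta>. \<forall>k. w \<in> R' (initial \<beta> k))"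
      unfolding R'_eq[symmetric] by (metis prod_decode_inverse surj_pair)
    finally show "w \<in> (\<Inter>m. E m) \<longleftrightarrow> (\<exists>\<beta>. \<forall>k. w \<in> R' (initial \<beta> k))"
      by (simp add: R(2))
  qed
qed

text \<open>Suslin sets are in general not closed under complements. The induction therefore runs over the property that
  a set and its complement are both Suslin, which countable unions preserve.\<close>

lemma sigma_sets_subset_suslin:
  assumes P: "\<Omega> \<in> P" "{} \<in> P" "\<And>A. A \<in> P \<Longrightarrow> A \<subseteq> \<Omega>"
    and G: "\<And>A. A \<in> G \<Longrightarrow> A \<subseteq> \<Omega>" "\<And>A. A \<in> G \<Longrightarrow> A \<in> suslin P" "\<And>A. A \<in> G \<Longrightarrow> \<Omega> - A \<in> suslin P"
  shows "sigma_sets \<Omega> G \<subseteq> suslin P"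
proof
  fix A assume "A \<in> sigma_sets \<Omega> G"
  then have "A \<in> suslin P \<and> \<Omega> - A \<in> suslin P"
  proof induction
    case (Compl a)
    have "a \<subseteq> \<Omega>" using Compl.hyps G(1) sigma_sets_into_sp[of G \<Omega>] by blast
    then show ?case using Compl.IH by (simp add: double_diff)
  next
    case (Union a)
    have "\<Omega> - (\<Union>i. a i) = (\<Inter>i. \<Omega> - a i)" by blast
    then show ?case using Union.IH suslin_UN[OF P(1,3), of a] suslin_INT[of "\<lambda>i. \<Omega> - a i"] by simp
  qed (use G P suslin_base in auto)
  then show "A \<in> suslin P" ..
qed

section \<open>Projections along Polish spaces\<close>

text \<open>The only features of a complete separable metric that the projection theorem needs: closed balls
  of radius \<open>1 / (k + 1)\<close> around the points of a countable dense set cover the space for each \<open>k\<close>, they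
  form a network for the topology, and a decreasing sequence of nonempty closed sets has a common
  point if for every \<open>k\<close> some member fits into a ball of the \<open>k\<close>-th cover.\<close>

lemma polish_closed_covers:
  assumes "polish_topology Y"
  obtains D :: "nat \<Rightarrow> nat \<Rightarrow> 'a set" where
    "\<forall>i k. closedin Y (D i k)"
    "\<forall>y\<in>topspace Y. \<forall>k. \<exists>i. y \<in> D i k"
    "\<forall>W y. openin Y W \<longrightarrow> y \<in> W \<longrightarrow> (\<exists>i k. y \<in> D i k \<and> D i k \<subseteq> W)"
    "\<forall>C \<beta>. (\<forall>n :: nat. closedin Y (C n) \<and> C n \<noteq> {}) \<longrightarrow> decseq C \<longrightarrow>
      (\<forall>k. \<exists>n. C n \<subseteq> D (\<beta> k) k) \<longrightarrow> \<Inter> (range C) \<noteq> {}"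
proof -
  obtain M d where Md: "Metric_space M d" "Metric_space.mcomplete M d"
    and Y_eq: "Y = Metric_space.mtopology M d"
    using assms unfolding polish_topology_def completely_metrizable_space_def by blast
  interpret Metric_space M d by (rule Md)
  obtain C where C: "countable C" "C \<subseteq> M" "mtopology closure_of C = M"
    using assms unfolding polish_topology_def separable_space_def Y_eq by auto
  define c where "c = from_nat_into C"
  define D where "D i k = mcball (c i) (1 / Suc k)" for i k
  have closedD: "closedin Y (D i k)" for i k
    by (simp add: D_def Y_eq)
  have near: "\<exists>i. y \<in> D i k" if "y \<in> M" for y k
  proof -
    have "y \<in> mtopology closure_of C" using C that by simp
    then have "\<forall>r>0. \<exists>x\<in>C. x \<in> mball y r"
      by (simp only: metric_closure_of mem_Collect_eq) (elim conjE)
    then have "\<exists>x\<in>C. x \<in> mball y (1 / Suc k)"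
      by (rule allE[of _ "1 / Suc k"])
        (simp only: of_nat_0_less_iff zero_less_Suc zero_less_divide_1_iff simp_thms)
    then obtain x where x: "x \<in> C" "x \<in> mball y (1 / Suc k)" ..
    then have "y \<in> mcball x (1 / Suc k)" by (auto simp: commute)
    moreover have "c (to_nat_on C x) = x" using x C by (simp add: c_def)
    ultimately show ?thesis unfolding D_def by metis
  qed
  show thesis
  proof
    show "\<forall>i k. closedin Y (D i k)" using closedD by blast
    show "\<forall>y\<in>topspace Y. \<forall>k. \<exists>i. y \<in> D i k"
      using near by (simp add: Y_eq)
    show "\<forall>W y. openin Y W \<longrightarrow> y \<in> W \<longrightarrow> (\<exists>i k. y \<in> D i k \<and> D i k \<subseteq> W)"
    proof (intro allI impI)
      fix W y assume W: "openin Y W" "y \<in> W"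
      have "y \<in> M" using W openin_subset[of Y W] by (auto simp: Y_eq)
      obtain r where r: "r > 0" "mball y r \<subseteq> W"
        using W unfolding Y_eq openin_mtopology by blast
      obtain k where k: "1 / real (Suc k) < r / 2" using nat_approx_posE[of "r / 2"] r by auto
      obtain i where i: "y \<in> D i k" using near[OF \<open>y \<in> M\<close>] by blast
      have "D i k \<subseteq> mball y r"
      proof
        fix x assume x: "x \<in> D i k"
        have "d y x \<le> d y (c i) + d (c i) x"
          using x i by (intro triangle) (auto simp: D_def)
        then show "x \<in> mball y r"
          using x i k by (auto simp: D_def commute)
      qed
      then show "\<exists>i k. y \<in> D i k \<and> D i k \<subseteq> W" using i r by blast
    qed
    show "\<forall>C \<beta>. (\<forall>n :: nat. closedin Y (C n) \<and> C n \<noteq> {}) \<longrightarrow> decseq C \<longrightarrow>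
      (\<forall>k. \<exists>n. C n \<subseteq> D (\<beta> k) k) \<longrightarrow> \<Inter> (range C) \<noteq> {}"
    proof (intro allI impI)
      fix C :: "nat \<Rightarrow> 'a set" and \<beta>
      assume C: "\<forall>n. closedin Y (C n) \<and> C n \<noteq> {}" "decseq C" "\<forall>k. \<exists>n. C n \<subseteq> D (\<beta> k) k"
      show "\<Inter> (range C) \<noteq> {}"
      proof (rule Md(2)[unfolded mcomplete_nest, rule_format], intro conjI allI impI)
        show "closedin mtopology (C n)" for n using C(1) by (simp add: Y_eq)
        show "\<exists>n a. C n \<subseteq> mcball a \<epsilon>" if \<epsilon>: "\<epsilon> > 0" for \<epsilon> :: real
        proof -
          obtain k where "1 / real (Suc k) < \<epsilon>" using nat_approx_posE[OF \<epsilon>] by metis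
          then have "D (\<beta> k) k \<subseteq> mcball (c (\<beta> k)) \<epsilon>"
            unfolding D_def by (intro mcball_subset_concentric less_imp_le)
          then show ?thesis using C(3) by blast
        qed
      qed (use C(1,2) in auto)
    qed
  qed
qed

definition closed_rectangles :: "'a topology \<Rightarrow> 'b topology \<Rightarrow> ('a \<times> 'b) set set"
  where "closed_rectangles Z Y = {A \<times> K | A K. A \<in> sets (borel_of Z) \<and> closedin Y K}"

lemma openin_sets_borel_of: "openin X U \<Longrightarrow> U \<in> sets (borel_of X)"
  unfolding sets_borel_of by (auto intro: sigma_sets.Basic)

text \<open>An open set is a countable union of rectangles \<open>V \<times> D\<close> with \<open>V\<close> open and \<open>D\<close> from the covers,
  because for each of the countably many \<open>D\<close> one may take the largest possible \<open>V\<close>. The complement of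
  such a rectangle is again a countable union of rectangles, and the Suslin sets over the rectangles
  are closed under countable unions and intersections.\<close>

lemma borel_prod_subset_suslin_rectangles:
  fixes Z :: "'a topology" and Y :: "'b topology"
  assumes "polish_topology Y"
  shows "sets (borel_of (prod_topology Z Y)) \<subseteq> suslin (closed_rectangles Z Y)"
proof -
  from polish_closed_covers[OF assms] obtain D :: "nat \<Rightarrow> nat \<Rightarrow> 'b set" where D: "\<forall>i k. closedin Y (D i k)"
    "\<forall>W y. openin Y W \<longrightarrow> y \<in> W \<longrightarrow> (\<exists>i k. y \<in> D i k \<and> D i k \<subseteq> W)" .
  from D have closedD: "\<And>i k. closedin Y (D i k)"
    and open_near: "\<And>W y. openin Y W \<Longrightarrow> y \<in> W \<Longrightarrow> \<exists>i k. y \<in> D i k \<and> D i k \<subseteq> W" by blast+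
  define P where "P = closed_rectangles Z Y"
  have PI: "A \<times> K \<in> P" if "A \<in> sets (borel_of Z)" "closedin Y K" for A K
    unfolding P_def closed_rectangles_def using that by blast
  define \<Omega> where "\<Omega> = topspace Z \<times> topspace Y"
  have P\<Omega>: "\<Omega> \<in> P" "{} \<in> P" "\<And>A. A \<in> P \<Longrightarrow> A \<subseteq> \<Omega>"
  proof -
    show "\<Omega> \<in> P" unfolding \<Omega>_def by (intro PI openin_sets_borel_of) simp_all
    show "{} \<in> P" using PI[of "{}" "{}"] by simp
    show "A \<subseteq> \<Omega>" if "A \<in> P" for A
    proof -
      from that obtain A' K where "A = A' \<times> K" "A' \<in> sets (borel_of Z)" "closedin Y K"
        unfolding P_def closed_rectangles_def by blast
      moreover from this have "A' \<subseteq> topspace Z" using sets.sets_into_space by fastforce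
      ultimately show ?thesis using closedin_subset[of Y K] unfolding \<Omega>_def by blast
    qed
  qed
  have gen: "U \<subseteq> \<Omega>" "U \<in> suslin P" "\<Omega> - U \<in> suslin P" if U: "openin (prod_topology Z Y) U" for U
  proof -
    show "U \<subseteq> \<Omega>" using openin_subset[OF U] by (simp add: \<Omega>_def)
    define V where "V i k = \<Union>{V. openin Z V \<and> V \<times> D i k \<subseteq> U}" for i k
    have openV: "openin Z (V i k)" for i k unfolding V_def by blast
    have U_eq: "U = (\<Union>m. case prod_decode m of (i, k) \<Rightarrow> V i k \<times> D i k)"
    proof
      show "U \<subseteq> (\<Union>m. case prod_decode m of (i, k) \<Rightarrow> V i k \<times> D i k)"
      proof clarify
        fix z y assume "(z, y) \<in> U"
        then obtain V' W where VW: "openin Z V'" "openin Y W" "z \<in> V'" "y \<in> W" "V' \<times> W \<subseteq> U"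
          using openin_prod_topology_alt[THEN iffD1, OF U, rule_format] by metis
        obtain i k where ik: "y \<in> D i k" "D i k \<subseteq> W" using open_near[OF VW(2,4)] by metis
        then have "V' \<times> D i k \<subseteq> U" using VW(5) by (meson Sigma_mono order_refl order_trans)
        then have "z \<in> V i k" unfolding V_def using VW(1,3) by blast
        with ik have "(z, y) \<in> V i k \<times> D i k" by simp
        then show "(z, y) \<in> (\<Union>m. case prod_decode m of (i, k) \<Rightarrow> V i k \<times> D i k)"
          by (intro UN_I[of "prod_encode (i, k)"]) auto
      qed
      show "(\<Union>m. case prod_decode m of (i, k) \<Rightarrow> V i k \<times> D i k) \<subseteq> U"
        by (auto simp: V_def split: prod.splits)
    qed
    have "(case prod_decode m of (i, k) \<Rightarrow> V i k \<times> D i k) \<in> P" for m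
      by (simp add: PI openin_sets_borel_of[OF openV] closedD split: prod.split)
    then show "U \<in> suslin P"
      unfolding U_eq by (intro suslin_UN[OF P\<Omega>(1,3)] suslin_base)
    have comp: "\<Omega> - V i k \<times> D i k \<in> suslin P" for i k
    proof -
      define E where "E m = (case m of 0 \<Rightarrow> (topspace Z - V i k) \<times> topspace Y
        | Suc n \<Rightarrow> (case prod_decode n of (j, l) \<Rightarrow>
            if D j l \<inter> D i k = {} then topspace Z \<times> D j l else {}))" for m
      have "E m \<in> P" for m
      proof (cases m)
        case 0
        have "topspace Z - V i k \<in> sets (borel_of Z)"
          using sets.compl_sets[OF openin_sets_borel_of[OF openV]] by simp
        then show ?thesis by (simp add: E_def 0 PI)
      next
        case (Suc n)
        have "topspace Z \<times> D j l \<in> P" for j l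
          using openin_sets_borel_of[OF openin_topspace] closedD by (rule PI)
        then show ?thesis unfolding E_def Suc using P\<Omega>(2) by (simp split: prod.split)
      qed
      moreover have "\<Omega> - V i k \<times> D i k = (\<Union>m. E m)"
      proof
        show "\<Omega> - V i k \<times> D i k \<subseteq> (\<Union>m. E m)"
        proof (rule subrelI)
          fix z y assume zy: "(z, y) \<in> \<Omega> - V i k \<times> D i k"
          show "(z, y) \<in> (\<Union>m. E m)"
          proof (cases "y \<in> D i k")
            case True
            then have "(z, y) \<in> E 0" using zy by (simp add: E_def \<Omega>_def)
            then show ?thesis by blast
          next
            case False
            then have "y \<in> topspace Y - D i k" using zy by (simp add: \<Omega>_def)
            moreover have "openin Y (topspace Y - D i k)" by (simp add: openin_diff closedD)
            ultimately obtain j l where jl: "y \<in> D j l" "D j l \<subseteq> topspace Y - D i k"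
              using open_near by metis
            then have "D j l \<inter> D i k = {}" by blast
            then have "(z, y) \<in> E (Suc (prod_encode (j, l)))"
              using zy jl(1) by (simp add: E_def \<Omega>_def)
            then show ?thesis by blast
          qed
        qed
        have "D j l \<subseteq> topspace Y" for j l using closedin_subset[OF closedD] .
        moreover have "V i k \<subseteq> topspace Z" using openin_subset[OF openV] .
        ultimately show "(\<Union>m. E m) \<subseteq> \<Omega> - V i k \<times> D i k"
          by (fastforce simp: E_def \<Omega>_def split: nat.splits prod.splits if_splits)
      qed
      ultimately show ?thesis by (simp add: suslin_UN[OF P\<Omega>(1,3)] suslin_base)
    qed
    have "\<Omega> - (\<Union>m. F m) = (\<Inter>m. \<Omega> - F m)" for F :: "nat \<Rightarrow> ('a \<times> 'b) set"
      by blast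
    then have "\<Omega> - U = (\<Inter>m. \<Omega> - (case prod_decode m of (i, k) \<Rightarrow> V i k \<times> D i k))"
      by (subst U_eq)
    also have "\<dots> \<in> suslin P"
      by (intro suslin_INT) (simp split: prod.split add: comp)
    finally show "\<Omega> - U \<in> suslin P" .
  qed
  have "sigma_sets \<Omega> {U. openin (prod_topology Z Y) U} \<subseteq> suslin P"
    by (rule sigma_sets_subset_suslin[OF P\<Omega>]) (use gen in auto)
  then show ?thesis unfolding sets_borel_of \<Omega>_def P_def by simp
qed

text \<open>Let \<open>B\<close> be the result of the Suslin operation applied to rectangles \<open>A\<^sub>s \<times> K\<^sub>s\<close>. A point \<open>z\<close> lies in
  the projection if and only if some \<open>\<alpha>\<close> satisfies \<open>z \<in> A\<^bsub>\<alpha>|n\<^esub>\<close> for all \<open>n\<close> while all \<open>K\<^bsub>\<alpha>|n\<^esub>\<close> share a point.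
  The second condition does not involve \<open>z\<close>. A second sequence \<open>\<beta>\<close> names small closed sets around the
  hypothetical common point; by completeness the common point then exists as soon as all finite
  intersections are nonempty. So \<open>y\<close> is eliminated in favour of a condition on the initial segments of
  the pair \<open>(\<alpha>, \<beta>)\<close>.\<close>

lemma projection_borel_suslin:
  fixes Z :: "'a topology" and Y :: "'b topology"
  assumes Y: "polish_topology Y" and B: "B \<in> sets (borel_of (prod_topology Z Y))"
  shows "fst ` B \<in> suslin (sets (borel_of Z))"
proof -
  from polish_closed_covers[OF Y] obtain D :: "nat \<Rightarrow> nat \<Rightarrow> 'b set" where
    closedD: "\<forall>i k. closedin Y (D i k)"
    and near: "\<forall>y\<in>topspace Y. \<forall>k. \<exists>i. y \<in> D i k"
    and nest: "\<forall>C \<beta>. (\<forall>n :: nat. closedin Y (C n) \<and> C n \<noteq> {}) \<longrightarrow> decseq C \<longrightarrow>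
      (\<forall>k. \<exists>n. C n \<subseteq> D (\<beta> k) k) \<longrightarrow> \<Inter> (range C) \<noteq> {}" .
  have "B \<in> suslin (closed_rectangles Z Y)"
    using borel_prod_subset_suslin_rectangles[OF Y] B by blast
  then obtain R where R: "\<And>s. R s \<in> closed_rectangles Z Y"
      "\<And>w. w \<in> B \<longleftrightarrow> (\<exists>\<alpha>. \<forall>n. w \<in> R (initial \<alpha> n))"
    by (rule suslinE) blast
  have "\<forall>s. \<exists>A K. R s = A \<times> K \<and> A \<in> sets (borel_of Z) \<and> closedin Y K"
    using R(1) unfolding closed_rectangles_def by blast
  then obtain A K where AK: "\<And>s. R s = A s \<times> K s" "\<And>s. A s \<in> sets (borel_of Z)"
    "\<And>s. closedin Y (K s)" by metis
  define W where "W \<alpha> \<beta> n = (\<Inter>k\<le>n. K (initial \<alpha> k)) \<inter> (\<Inter>k<n. D (\<beta> k) k)" for \<alpha> \<beta> n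
  define G where "G u = (let \<alpha> = (\<lambda>k. fst (prod_decode (u ! k))); \<beta> = (\<lambda>k. snd (prod_decode (u ! k)))
    in if W \<alpha> \<beta> (length u) \<noteq> {} then A (initial \<alpha> (length u)) else {})" for u
  have G_initial: "G (initial \<gamma> n) = (let \<alpha> = (\<lambda>k. fst (prod_decode (\<gamma> k)));
      \<beta> = (\<lambda>k. snd (prod_decode (\<gamma> k)))
    in if W \<alpha> \<beta> n \<noteq> {} then A (initial \<alpha> n) else {})" for \<gamma> n
  proof -
    have W_cong: "W \<alpha> \<beta> n = W \<alpha>' \<beta>' n"
      if "\<And>k. k < n \<Longrightarrow> \<alpha> k = \<alpha>' k" "\<And>k. k < n \<Longrightarrow> \<beta> k = \<beta>' k" for \<alpha> \<beta> \<alpha>' \<beta>'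
    proof -
      have "K (initial \<alpha> k) = K (initial \<alpha>' k)" if "k \<le> n" for k
        using that \<open>\<And>k. k < n \<Longrightarrow> \<alpha> k = \<alpha>' k\<close> by (intro arg_cong[where f = K] map_cong) auto
      with that(2) show ?thesis by (simp add: W_def)
    qed
    have "W (\<lambda>k. fst (prod_decode (initial \<gamma> n ! k))) (\<lambda>k. snd (prod_decode (initial \<gamma> n ! k))) n
        = W (\<lambda>k. fst (prod_decode (\<gamma> k))) (\<lambda>k. snd (prod_decode (\<gamma> k))) n"
      by (rule W_cong) simp_all
    moreover have "A (initial (\<lambda>k. fst (prod_decode (initial \<gamma> n ! k))) n)
        = A (initial (\<lambda>k. fst (prod_decode (\<gamma> k))) n)"
      by (intro arg_cong[where f = A] map_cong) simp_all
    ultimately show ?thesis by (simp add: G_def Let_def)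
  qed
  show ?thesis
  proof (rule suslinI)
    show "G u \<in> sets (borel_of Z)" for u
      using AK(2) by (simp add: G_def Let_def)
    fix z
    show "z \<in> fst ` B \<longleftrightarrow> (\<exists>\<gamma>. \<forall>n. z \<in> G (initial \<gamma> n))"
    proof
      assume "z \<in> fst ` B"
      then obtain y where "(z, y) \<in> B" by force
      then obtain \<alpha> where \<alpha>: "\<And>n. (z, y) \<in> A (initial \<alpha> n) \<times> K (initial \<alpha> n)"
        unfolding R(2) AK(1) by blast
      have "y \<in> topspace Y" using \<alpha>[of 0] closedin_subset[OF AK(3)] by force
      then obtain \<beta> where \<beta>: "\<And>k. y \<in> D (\<beta> k) k" using near by metis
      have "y \<in> W \<alpha> \<beta> n" for n using \<alpha> \<beta> by (auto simp: W_def)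
      then have "\<forall>n. z \<in> G (initial (\<lambda>k. prod_encode (\<alpha> k, \<beta> k)) n)"
        unfolding G_initial using \<alpha> by (auto simp: Let_def)
      then show "\<exists>\<gamma>. \<forall>n. z \<in> G (initial \<gamma> n)" by blast
    next
      assume "\<exists>\<gamma>. \<forall>n. z \<in> G (initial \<gamma> n)"
      then obtain \<gamma> where \<gamma>: "\<And>n. z \<in> G (initial \<gamma> n)" by blast
      define \<alpha> where "\<alpha> = (\<lambda>k. fst (prod_decode (\<gamma> k)))"
      define \<beta> where "\<beta> = (\<lambda>k. snd (prod_decode (\<gamma> k)))"
      have ne: "W \<alpha> \<beta> n \<noteq> {}" and zA: "z \<in> A (initial \<alpha> n)" for n
        using \<gamma>[of n] unfolding G_initial Let_def \<alpha>_def \<beta>_def by (auto split: if_splits)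
      have "\<Inter> (range (W \<alpha> \<beta>)) \<noteq> {}"
      proof (rule nest[rule_format])
        have "closedin Y (W \<alpha> \<beta> n)" for n
        proof (cases n)
          case 0
          then show ?thesis using AK(3) by (simp add: W_def)
        next
          case (Suc m)
          then show ?thesis
            using AK(3) closedD unfolding W_def by (intro closedin_Int closedin_Inter) auto
        qed
        with ne show "closedin Y (W \<alpha> \<beta> n) \<and> W \<alpha> \<beta> n \<noteq> {}" for n by blast
        show "decseq (W \<alpha> \<beta>)" by (rule decseq_SucI) (auto simp: W_def)
        show "\<exists>n. W \<alpha> \<beta> n \<subseteq> D (\<beta> k) k" for k
          unfolding W_def by (intro exI[of _ "Suc k"]) auto
      qed
      then obtain y where "\<And>n. y \<in> W \<alpha> \<beta> n" by blast
      then have "y \<in> K (initial \<alpha> n)" for n unfolding W_def by blast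
      with zA have "(z, y) \<in> B" unfolding R(2) AK(1) by blast
      then show "z \<in> fst ` B" by force
    qed
  qed
qed

text \<open>The normal form of coanalytic sets that the reduction starts from: membership means that a tree
  of finite sequences, depending on the point in a Borel way, has no infinite branch. Requiring the
  Suslin condition at all initial segments of \<open>s\<close> makes the family a tree without changing its
  branches.\<close>

lemma coanalytic_well_founded_trees:
  assumes "pi11 Z B"
  obtains T where "\<And>s. {z \<in> topspace Z. s \<in> T z} \<in> sets (borel_of Z)"
    "\<And>z s k. s \<in> T z \<Longrightarrow> take k s \<in> T z"
    "\<And>z. z \<in> topspace Z \<Longrightarrow> z \<in> B \<longleftrightarrow> (\<nexists>\<alpha>. \<forall>n. initial \<alpha> n \<in> T z)"
proof -
  from assms obtain Y :: "(nat \<Rightarrow> real) topology" and C where B: "B \<subseteq> topspace Z" and Y: "polish_topology Y"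
      and C: "C \<in> sets (borel_of (prod_topology Z Y))" "topspace Z - B = fst ` C"
    unfolding pi11_def sigma11_def by blast
  have "topspace Z - B \<in> suslin (sets (borel_of Z))"
    unfolding C(2) by (rule projection_borel_suslin[OF Y C(1)])
  then obtain G where G: "\<And>s. G s \<in> sets (borel_of Z)"
      "\<And>z. z \<in> topspace Z - B \<longleftrightarrow> (\<exists>\<alpha>. \<forall>n. z \<in> G (initial \<alpha> n))"
    by (rule suslinE) blast
  define T where "T z = {s. \<forall>k\<le>length s. z \<in> G (take k s)}" for z
  show thesis
  proof
    show "{z \<in> topspace Z. s \<in> T z} \<in> sets (borel_of Z)" for s
    proof -
      have "G u \<subseteq> topspace Z" for u using sets.sets_into_space[OF G(1), of u] by simp
      then have "{z \<in> topspace Z. s \<in> T z} = (\<Inter>k\<in>{..length s}. G (take k s))"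
        unfolding T_def by auto
      also have "\<dots> \<in> sets (borel_of Z)" by (intro sets.finite_INT G) auto
      finally show ?thesis .
    qed
    show "take k s \<in> T z" if "s \<in> T z" for z s k
      using that by (auto simp: T_def min_def)
    have "initial \<alpha> n \<in> T z \<longleftrightarrow> (\<forall>k\<le>n. z \<in> G (initial \<alpha> k))" for \<alpha> n z
      by (auto simp: T_def take_map min_def)
    then have "(\<forall>n. initial \<alpha> n \<in> T z) \<longleftrightarrow> (\<forall>n. z \<in> G (initial \<alpha> n))" for \<alpha> z
      by blast
    then show "z \<in> B \<longleftrightarrow> (\<nexists>\<alpha>. \<forall>n. initial \<alpha> n \<in> T z)" if "z \<in> topspace Z" for z
      using G(2)[of z] that by simp blast
  qed
qed

section \<open>One-dimensional Hausdorff measure\<close>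

lemma hausdorff1_size_le:
  assumes "E \<subseteq> (\<Union>i. C i)" "\<And>i :: nat. bounded (C i)" "\<And>i. diameter (C i) \<le> \<delta>"
  shows "hausdorff1_size \<delta> E \<le> (\<Sum>i. ennreal (diameter (C i)))"
  unfolding hausdorff1_size_def using assms by (intro INF_lower) auto

lemma hausdorff1_eq_0_iff: "hausdorff1 E = 0 \<longleftrightarrow> (\<forall>\<delta>>0. hausdorff1_size \<delta> E = 0)"
proof -
  have "hausdorff1 E \<le> 0 \<longleftrightarrow> (\<forall>\<delta>>0. hausdorff1_size \<delta> E \<le> 0)"
    unfolding hausdorff1_def SUP_le_iff by auto
  then show ?thesis by simp
qed

lemma hausdorff1_countable:
  fixes E :: "'a::metric_space set"
  assumes "countable E"
  shows "hausdorff1 E = 0"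
  unfolding hausdorff1_eq_0_iff
proof (intro allI impI)
  fix \<delta> :: real assume "\<delta> > 0"
  (* from_nat_into has an unspecified value on the empty set *)
  define C where "C i = (if E = {} then {} else {from_nat_into E i})" for i
  have "hausdorff1_size \<delta> E \<le> (\<Sum>i. ennreal (diameter (C i)))"
  proof (rule hausdorff1_size_le)
    show "E \<subseteq> (\<Union>i. C i)"
    proof
      fix x assume "x \<in> E"
      then have "x \<in> C (to_nat_on E x)" using assms by (auto simp: C_def)
      then show "x \<in> (\<Union>i. C i)" by blast
    qed
  qed (use \<open>\<delta> > 0\<close> in \<open>auto simp: C_def\<close>)
  also have "(\<lambda>i. ennreal (diameter (C i))) = (\<lambda>i. 0)" by (auto simp: C_def)
  finally show "hausdorff1_size \<delta> E = 0" by simp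
qed

text \<open>A nonempty covering set lies in an open ball, centred at a point of the dense set, whose radius
  exceeds its diameter by as little as desired. Excesses in geometric progression keep the sum of the
  radii below the given bound. Open balls are wanted because compactness will be applied to them.\<close>

lemma hausdorff1_eq_0_ball_cover:
  fixes E :: "'a::metric_space set" and d :: "'i \<Rightarrow> 'a"
  assumes dense: "\<And>x e. 0 < e \<Longrightarrow> \<exists>i. dist (d i) x < e"
    and E: "hausdorff1 E = 0" and "0 < \<epsilon>"
  shows "\<exists>c r. E \<subseteq> (\<Union>n :: nat. ball (d (c n)) (r n)) \<and> (\<forall>n. 0 < r n) \<and>
    (\<forall>F. finite F \<longrightarrow> sum r F < \<epsilon>)"
proof -
  have "hausdorff1_size 1 E < ennreal (\<epsilon> / 4)"
    using E \<open>0 < \<epsilon>\<close> by (simp add: hausdorff1_eq_0_iff)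
  then obtain C where C: "E \<subseteq> (\<Union>i. C i)" "\<And>i :: nat. bounded (C i)"
      "(\<Sum>i. ennreal (diameter (C i))) < ennreal (\<epsilon> / 4)"
    unfolding hausdorff1_size_def INF_less_iff by blast
  have sum_diam: "(\<Sum>i\<in>F. diameter (C i)) < \<epsilon> / 4" if "finite F" for F
  proof -
    have "ennreal (\<Sum>i\<in>F. diameter (C i)) = (\<Sum>i\<in>F. ennreal (diameter (C i)))"
      using C(2) by (intro sum_ennreal[symmetric] diameter_ge_0)
    also have "\<dots> \<le> (\<Sum>i. ennreal (diameter (C i)))"
      by (intro sum_le_suminf) (use that in auto)
    also have "\<dots> < ennreal (\<epsilon> / 4)" by (rule C(3))
    finally show ?thesis by (simp add: ennreal_less_iff sum_nonneg C(2) diameter_ge_0)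
  qed
  define r where "r i = diameter (C i) + \<epsilon> / 4 * (1 / 2) ^ i" for i
  have r_pos: "0 < r i" for i
    using diameter_ge_0[OF C(2)[of i]] \<open>0 < \<epsilon>\<close> by (simp add: r_def add_nonneg_pos)
  have "\<exists>c. C i \<subseteq> ball (d c) (r i)" for i
  proof (cases "C i = {}")
    case False
    then obtain x where x: "x \<in> C i" by blast
    obtain c where c: "dist (d c) x < \<epsilon> / 4 * (1 / 2) ^ i"
      using dense[of "\<epsilon> / 4 * (1 / 2) ^ i" x] \<open>0 < \<epsilon>\<close> by auto
    have "dist (d c) y < r i" if "y \<in> C i" for y
      using dist_triangle[of "d c" y x] c diameter_bounded_bound[OF C(2) x that]
      by (simp add: r_def)
    then show ?thesis by (intro exI[of _ c]) auto
  qed simp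
  then obtain c where c: "\<And>i. C i \<subseteq> ball (d (c i)) (r i)" by metis
  show ?thesis
  proof (intro exI conjI allI impI)
    show "E \<subseteq> (\<Union>n. ball (d (c n)) (r n))" using C(1) c by blast
    show "0 < r n" for n by (rule r_pos)
    fix F :: "nat set" assume F: "finite F"
    have "(\<Sum>i\<in>F. (1 / 2 :: real) ^ i) \<le> (\<Sum>i. (1 / 2) ^ i)"
      by (intro sum_le_suminf) (use F in auto)
    also have "\<dots> = 2" by (subst suminf_geometric) auto
    finally have "\<epsilon> / 4 * (\<Sum>i\<in>F. (1 / 2 :: real) ^ i) \<le> \<epsilon> / 4 * 2"
      using \<open>0 < \<epsilon>\<close> by (intro mult_left_mono) auto
    moreover have "sum r F = (\<Sum>i\<in>F. diameter (C i)) + \<epsilon> / 4 * (\<Sum>i\<in>F. (1 / 2) ^ i)"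
      unfolding r_def sum.distrib sum_distrib_left ..
    ultimately show "sum r F < \<epsilon>"
      using sum_diam[OF F] \<open>0 < \<epsilon>\<close> by linarith
  qed
qed

lemma diameter_cball_le:
  fixes x :: "'a::metric_space"
  assumes "0 \<le> r"
  shows "diameter (cball x r) \<le> 2 * r"
proof -
  have "dist y z \<le> 2 * r" if "y \<in> cball x r" "z \<in> cball x r" for y z
    using that dist_triangle3[of y z x] by simp
  moreover have "x \<in> cball x r" using assms by simp
  ultimately show ?thesis
    unfolding diameter_def using assms by (auto intro!: cSUP_least)
qed

text \<open>If the radii sum up to less than \<open>\<delta> / 2\<close>, every diameter is below \<open>\<delta>\<close>. So a cover of small total
  size automatically consists of small sets.\<close>

lemma hausdorff1_eq_0_if_finite_covers:
  fixes E :: "'a::metric_space set"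
  assumes "\<And>\<epsilon>. 0 < \<epsilon> \<Longrightarrow> \<exists>F :: ('a \<times> real) list. E \<subseteq> (\<Union>(x, r)\<in>set F. cball x r) \<and>
      (\<forall>(x, r)\<in>set F. 0 < r) \<and> (\<Sum>(x, r)\<leftarrow>F. r) < \<epsilon>"
  shows "hausdorff1 E = 0"
  unfolding hausdorff1_eq_0_iff
proof (intro allI impI)
  fix \<delta> :: real assume "\<delta> > 0"
  have "hausdorff1_size \<delta> E \<le> ennreal \<epsilon>" if "0 < \<epsilon>" for \<epsilon>
  proof -
    define \<eta> where "\<eta> = min \<epsilon> \<delta> / 2"
    have "0 < \<eta>" using \<open>0 < \<epsilon>\<close> \<open>0 < \<delta>\<close> by (simp add: \<eta>_def)
    from assms[OF this] obtain F where F: "E \<subseteq> (\<Union>(x, r)\<in>set F. cball x r)"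
      "\<And>x r. (x, r) \<in> set F \<Longrightarrow> 0 < r" "(\<Sum>(x, r)\<leftarrow>F. r) < \<eta>" by blast
    define C where "C i = (if i < length F then cball (fst (F ! i)) (snd (F ! i)) else {})" for i
    have pos: "0 < snd (F ! i)" if "i < length F" for i
      using F(2)[of "fst (F ! i)" "snd (F ! i)"] that by simp
    have diam: "diameter (C i) \<le> (if i < length F then 2 * snd (F ! i) else 0)" for i
    proof (cases "i < length F")
      case True
      then show ?thesis
        using pos[OF True] by (simp add: C_def diameter_cball_le)
    qed (simp add: C_def)
    have sum_eq: "(\<Sum>(x, r)\<leftarrow>F. r) = (\<Sum>i<length F. snd (F ! i))"
      by (simp add: sum_list_sum_nth case_prod_unfold atLeast0LessThan)
    have le: "snd (F ! i) \<le> \<eta>" if "i < length F" for i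
    proof -
      have "snd (F ! i) \<le> (\<Sum>i<length F. snd (F ! i))"
        using that pos by (intro member_le_sum) (auto intro: less_imp_le)
      then show ?thesis using F(3) sum_eq by simp
    qed
    have "hausdorff1_size \<delta> E \<le> (\<Sum>i. ennreal (diameter (C i)))"
    proof (rule hausdorff1_size_le)
      show "E \<subseteq> (\<Union>i. C i)"
        using F(1) by (fastforce simp: C_def in_set_conv_nth)
      show "bounded (C i)" for i by (simp add: C_def)
      show "diameter (C i) \<le> \<delta>" for i
        using diam[of i] le[of i] \<open>0 < \<delta>\<close> by (auto simp: \<eta>_def split: if_splits)
    qed
    also have "\<dots> = (\<Sum>i<length F. ennreal (diameter (C i)))"
      by (intro suminf_finite) (auto simp: C_def)
    also have "\<dots> \<le> (\<Sum>i<length F. ennreal (2 * snd (F ! i)))"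
    proof (intro sum_mono ennreal_leI)
      show "diameter (C i) \<le> 2 * snd (F ! i)" if "i \<in> {..<length F}" for i
        using diam[of i] that by simp
    qed
    also have "\<dots> = ennreal (\<Sum>i<length F. 2 * snd (F ! i))"
      using pos by (intro sum_ennreal) (auto intro: less_imp_le)
    also have "\<dots> \<le> ennreal \<epsilon>"
      using F(3) \<open>0 < \<eta>\<close> unfolding sum_eq
      by (intro ennreal_leI) (simp add: sum_distrib_left[symmetric] \<eta>_def)
    finally show ?thesis .
  qed
  then have "hausdorff1_size \<delta> E \<le> 0 + ennreal \<epsilon>" if "0 < \<epsilon>" for \<epsilon>
    using that by simp
  then have "hausdorff1_size \<delta> E \<le> 0" by (rule ennreal_le_epsilon)
  then show "hausdorff1_size \<delta> E = 0" by simp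
qed

text \<open>The second list of balls says that the closed set avoids a neighbourhood of the part of the
  compact set that the first list misses. This splits the condition into one on \<open>A\<close> alone, of the kind
  that generates the Effros structure, and one on \<open>K\<close> alone. Balls around points of a countable dense
  set with rational radii leave only countably many pairs of lists.\<close>

lemma hausdorff1_closed_Int_compact_eq_0_iff:
  fixes A K :: "'a::metric_space set" and d :: "'i \<Rightarrow> 'a"
  assumes dense: "\<And>x e. 0 < e \<Longrightarrow> \<exists>i. dist (d i) x < e" and A: "closed A" and K: "compact K"
  shows "hausdorff1 (A \<inter> K) = 0 \<longleftrightarrow> (\<forall>k :: nat. \<exists>U W :: ('i \<times> rat) list.
    (\<forall>(i, r)\<in>set U. 0 < r) \<and> (\<Sum>(i, r)\<leftarrow>U. real_of_rat r) < 1 / Suc k \<and>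
    (\<forall>(i, r)\<in>set W. 0 < r \<and> A \<inter> ball (d i) (2 * of_rat r) = {}) \<and>
    K \<subseteq> (\<Union>(i, r)\<in>set U. cball (d i) (of_rat r)) \<union> (\<Union>(i, r)\<in>set W. cball (d i) (of_rat r)))"
    (is "_ \<longleftrightarrow> (\<forall>k. \<exists>U W. ?P k U W)")
proof (intro iffI allI)
  fix k :: nat
  assume H: "hausdorff1 (A \<inter> K) = 0"
  define e where "e = 1 / real (Suc k)"
  have "0 < e / 2" by (simp add: e_def)
  from hausdorff1_eq_0_ball_cover[of d, OF dense H this]
  obtain c :: "nat \<Rightarrow> 'i" and r where cr: "A \<inter> K \<subseteq> (\<Union>n. ball (d (c n)) (r n))" "\<And>n. 0 < r n"
      "\<And>F. finite F \<Longrightarrow> sum r F < e / 2" by blast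
  \<comment> \<open>Doubling the radii leaves room for a rational number.\<close>
  have "\<exists>q. r n < real_of_rat q \<and> real_of_rat q < 2 * r n" for n
    using of_rat_dense[of "r n" "2 * r n"] cr(2)[of n] by auto
  then obtain q where q: "\<And>n. r n < real_of_rat (q n)" "\<And>n. real_of_rat (q n) < 2 * r n" by metis
  define \<W> where "\<W> = {(i, s :: rat). 0 < s \<and> A \<inter> ball (d i) (2 * of_rat s) = {}}"
  define b where "b = (\<lambda>(i, s). ball (d i) (real_of_rat s))"
  have "K \<subseteq> (\<Union>p\<in>range (\<lambda>n. (c n, q n)) \<union> \<W>. b p)"
  proof
    fix x assume x: "x \<in> K"
    show "x \<in> (\<Union>p\<in>range (\<lambda>n. (c n, q n)) \<union> \<W>. b p)"
    proof (cases "x \<in> A")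
      case True
      then obtain n where "x \<in> ball (d (c n)) (r n)" using x cr(1) by blast
      then have "x \<in> b (c n, q n)" using q(1)[of n] by (simp add: b_def)
      then show ?thesis by blast
    next
      case False
      then obtain e where e: "0 < e" "ball x e \<subseteq> - A"
        using A by (metis ComplI openE open_Compl)
      obtain s where s: "0 < real_of_rat s" "real_of_rat s < e / 3"
        using of_rat_dense[of 0 "e / 3"] e by auto
      obtain i where i: "dist (d i) x < real_of_rat s" using dense s by blast
      have "ball (d i) (2 * of_rat s) \<subseteq> ball x e"
      proof
        fix y assume "y \<in> ball (d i) (2 * of_rat s)"
        then show "y \<in> ball x e"
          using dist_triangle3[of x y "d i"] i s by simp
      qed
      then have "(i, s) \<in> \<W>" using e s by (auto simp: \<W>_def)
      moreover have "x \<in> b (i, s)" using i by (simp add: b_def)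
      ultimately show ?thesis by blast
    qed
  qed
  moreover have "open (b p)" for p by (simp add: b_def split: prod.split)
  ultimately obtain F where F: "F \<subseteq> range (\<lambda>n. (c n, q n)) \<union> \<W>" "finite F" "K \<subseteq> (\<Union>p\<in>F. b p)"
    using compactE_image[OF K, of "range (\<lambda>n. (c n, q n)) \<union> \<W>" b] by metis
  have "finite (F - \<W>)" "F - \<W> \<subseteq> range (\<lambda>n. (c n, q n))" using F by auto
  then obtain N where N: "finite N" "F - \<W> = (\<lambda>n. (c n, q n)) ` N"
    using finite_subset_image[of "F - \<W>" "\<lambda>n. (c n, q n)" UNIV] by auto
  define U where "U = map (\<lambda>n. (c n, q n)) (sorted_list_of_set N)"
  obtain W where W: "set W = F \<inter> \<W>" using finite_list[of "F \<inter> \<W>"] F(2) by auto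
  have "(\<Sum>(i, r)\<leftarrow>U. real_of_rat r) = (\<Sum>n\<in>N. real_of_rat (q n))"
    using N(1) by (simp add: U_def comp_def sum_list_distinct_conv_sum_set)
  also have "\<dots> \<le> (\<Sum>n\<in>N. 2 * r n)" by (intro sum_mono less_imp_le q(2))
  also have "\<dots> < e" using cr(3)[OF N(1)] by (simp add: sum_distrib_left[symmetric])
  finally have "(\<Sum>(i, r)\<leftarrow>U. real_of_rat r) < 1 / Suc k" by (simp only: e_def)
  moreover have "0 < q n" for n
  proof -
    have "0 < real_of_rat (q n)" using q(1)[of n] cr(2)[of n] by linarith
    then show ?thesis by simp
  qed
  then have "\<forall>(i, r)\<in>set U. 0 < r" by (auto simp: U_def)
  moreover have "K \<subseteq> (\<Union>(i, r)\<in>set U. cball (d i) (of_rat r)) \<union> (\<Union>(i, r)\<in>set W. cball (d i) (of_rat r))"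
  proof
    fix x assume "x \<in> K"
    then obtain p where "p \<in> F" "x \<in> b p" using F(3) by blast
    moreover have "set U = F - \<W>" using N by (simp add: U_def)
    ultimately have p: "p \<in> set U \<or> p \<in> set W" using W by blast
    obtain i r where ir: "p = (i, r)" by (cases p)
    then have "x \<in> cball (d i) (of_rat r)" using \<open>x \<in> b p\<close> by (simp add: b_def)
    with p ir show "x \<in> (\<Union>(i, r)\<in>set U. cball (d i) (of_rat r)) \<union> (\<Union>(i, r)\<in>set W. cball (d i) (of_rat r))"
      by blast
  qed
  moreover have "\<forall>(i, r)\<in>set W. 0 < r \<and> A \<inter> ball (d i) (2 * of_rat r) = {}"
    by (auto simp: W \<W>_def)
  ultimately show "\<exists>U W. ?P k U W" by (intro exI[of _ U] exI[of _ W] conjI)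
next
  assume *: "\<forall>k. \<exists>U W. ?P k U W"
  show "hausdorff1 (A \<inter> K) = 0"
  proof (rule hausdorff1_eq_0_if_finite_covers)
    fix \<epsilon> :: real assume "0 < \<epsilon>"
    then obtain k where k: "1 / real (Suc k) < \<epsilon>" using nat_approx_posE by metis
    from spec[OF *, of k] obtain U W where UW: "?P k U W" by (elim exE) (rule that)
    have "A \<inter> cball (d i) (of_rat r) = {}" if "(i, r) \<in> set W" for i r
    proof -
      have "\<forall>(i, r)\<in>set W. 0 < r \<and> A \<inter> ball (d i) (2 * of_rat r) = {}" using UW by (elim conjE)
      then have r: "0 < r" "A \<inter> ball (d i) (2 * of_rat r) = {}" using that by auto
      then have "0 < real_of_rat r" by simp
      then have "cball (d i) (of_rat r) \<subseteq> ball (d i) (2 * of_rat r)"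
        by (intro subsetI, unfold mem_ball mem_cball) linarith
      then show ?thesis using r(2) by blast
    qed
    then have disj: "A \<inter> (\<Union>(i, r)\<in>set W. cball (d i) (of_rat r)) = {}"
      unfolding case_prod_unfold by (simp add: Int_UN_distrib)
    have "K \<subseteq> (\<Union>(i, r)\<in>set U. cball (d i) (of_rat r)) \<union> (\<Union>(i, r)\<in>set W. cball (d i) (of_rat r))"
      using UW by (elim conjE)
    with disj have sub: "A \<inter> K \<subseteq> (\<Union>(i, r)\<in>set U. cball (d i) (of_rat r))"
      by (simp only: disjoint_iff subset_iff Un_iff Int_iff) metis
    show "\<exists>F :: ('a \<times> real) list. A \<inter> K \<subseteq> (\<Union>(x, r)\<in>set F. cball x r) \<and>
        (\<forall>(x, r)\<in>set F. 0 < r) \<and> (\<Sum>(x, r)\<leftarrow>F. r) < \<epsilon>"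
    proof (intro exI conjI)
      let ?F = "map (\<lambda>(i, r). (d i, real_of_rat r)) U"
      show "A \<inter> K \<subseteq> (\<Union>(x, r)\<in>set ?F. cball x r)"
        using sub by (simp add: case_prod_unfold)
      show "\<forall>(x, r)\<in>set ?F. 0 < r"
        using conjunct1[OF UW] by (simp add: case_prod_unfold)
      show "(\<Sum>(x, r)\<leftarrow>?F. r) < \<epsilon>"
        using conjunct1[OF conjunct2[OF UW]] k by (simp add: case_prod_unfold comp_def)
    qed
  qed
qed

section \<open>Coding continuously differentiable curves by countably many values\<close>

text \<open>The values \<open>y (p, False)\<close> stand for \<open>f p\<close> and \<open>y (p, True)\<close> for the derivative of \<open>f\<close> at \<open>p\<close>, for rational
  \<open>p\<close> in the unit interval. The condition is differentiability
  that is uniform in the base point, which on a compact interval is the same as continuous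
  differentiability. Only rational data occur in it, which makes it a Borel condition on \<open>y\<close>.\<close>

definition C1_code :: "(rat \<times> bool \<Rightarrow> 'a::real_normed_vector) \<Rightarrow> bool"
  where "C1_code y \<longleftrightarrow> (\<forall>m :: nat. \<exists>k :: nat. \<forall>p\<in>{0..1}. \<forall>q\<in>{0..1}. \<bar>p - q\<bar> < 1 / of_nat (Suc k) \<longrightarrow>
    norm (y (p, False) - y (q, False) - of_rat (p - q) *\<^sub>R y (q, True)) \<le> 1 / Suc m * \<bar>real_of_rat (p - q)\<bar>)"

text \<open>The countable quantifiers, which make the condition Borel, replaced by real bounds.\<close>

lemma C1_code_eps:
  fixes y :: "rat \<times> bool \<Rightarrow> 'a::real_normed_vector"
  assumes y: "C1_code y" and "0 < (\<epsilon> :: real)"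
  obtains \<delta> :: real where "0 < \<delta>" "\<And>p q. p \<in> {0..1} \<Longrightarrow> q \<in> {0..1} \<Longrightarrow> \<bar>real_of_rat p - real_of_rat q\<bar> < \<delta> \<Longrightarrow>
    norm (y (p, False) - y (q, False) - (of_rat p - of_rat q) *\<^sub>R y (q, True)) \<le> \<epsilon> * \<bar>real_of_rat p - real_of_rat q\<bar>"
proof -
  obtain m where m: "1 / real (Suc m) < \<epsilon>" using nat_approx_posE[OF \<open>0 < \<epsilon>\<close>] by metis
  from y[unfolded C1_code_def, THEN spec[of _ m]] obtain k where
    k: "\<forall>p\<in>{0..1}. \<forall>q\<in>{0..1}. \<bar>p - q\<bar> < 1 / of_nat (Suc k) \<longrightarrow>
      norm (y (p, False) - y (q, False) - of_rat (p - q) *\<^sub>R y (q, True)) \<le> 1 / Suc m * \<bar>real_of_rat (p - q)\<bar>" ..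
  show thesis
  proof
    show "0 < 1 / real (Suc k)" by simp
    fix p q :: rat
    assume pq: "p \<in> {0..1}" "q \<in> {0..1}" "\<bar>real_of_rat p - real_of_rat q\<bar> < 1 / real (Suc k)"
    have "real_of_rat \<bar>p - q\<bar> < real_of_rat (1 / of_nat (Suc k))"
      using pq(3) by (simp only: of_rat_diff[symmetric] abs_of_rat of_rat_divide of_rat_of_nat_eq of_rat_1)
    then have "\<bar>p - q\<bar> < 1 / of_nat (Suc k)" by (simp only: of_rat_less)
    with k pq have "norm (y (p, False) - y (q, False) - of_rat (p - q) *\<^sub>R y (q, True))
        \<le> 1 / Suc m * \<bar>real_of_rat (p - q)\<bar>" by blast
    also have "\<dots> \<le> \<epsilon> * \<bar>real_of_rat (p - q)\<bar>" using m by (intro mult_right_mono) auto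
    finally show "norm (y (p, False) - y (q, False) - (of_rat p - of_rat q) *\<^sub>R y (q, True))
        \<le> \<epsilon> * \<bar>real_of_rat p - real_of_rat q\<bar>" by (simp add: of_rat_diff)
  qed
qed

lemma closure_unit_rationals: "closure (real_of_rat ` {0..1}) = {0..1}"
proof -
  have "real_of_rat ` {0..1} = {0..1} \<inter> \<rat>"
    by (auto simp: Rats_def)
  moreover have "closure ({0..1 :: real} \<inter> \<rat>) = {0..1}"
    using closure_convex_Int_superset[of "{0..1 :: real}" "\<rat>"] Rats_closure_real by simp
  ultimately show ?thesis by simp
qed

text \<open>Interchanging the two points in the uniform estimate shows that the coded derivative is uniformly
  continuous. It is then bounded, which makes the coded function uniformly continuous as well. Both
  extend to the closed interval by completeness, and the estimate passes to the limit.\<close>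

lemma C1_code_curve:
  fixes y :: "rat \<times> bool \<Rightarrow> 'a::{real_normed_vector, complete_space}"
  assumes y: "C1_code y"
  shows "\<exists>f. C1_curve f \<and> (\<forall>p\<in>{0..1}. f (of_rat p) = y (p, False))"
proof -
  let ?X = "real_of_rat ` {0..1}"
  define inv where "inv = (inv_into UNIV real_of_rat)"
  have inv: "inv (of_rat p) = p" for p by (simp add: inv_def inj_def)
  have "uniformly_continuous_on ?X (\<lambda>x. y (inv x, True))"
    unfolding uniformly_continuous_on_def
  proof (intro allI impI)
    fix \<epsilon> :: real assume "0 < \<epsilon>"
    then have "0 < \<epsilon> / 3" by simp
    from C1_code_eps[OF y this] obtain \<delta> where \<delta>: "0 < \<delta>"
      "\<And>p q. p \<in> {0..1} \<Longrightarrow> q \<in> {0..1} \<Longrightarrow> \<bar>real_of_rat p - real_of_rat q\<bar> < \<delta> \<Longrightarrow>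
        norm (y (p, False) - y (q, False) - (of_rat p - of_rat q) *\<^sub>R y (q, True))
          \<le> \<epsilon> / 3 * \<bar>real_of_rat p - real_of_rat q\<bar>" by blast
    have "norm (y (p, True) - y (q, True)) < \<epsilon>"
      if pq: "p \<in> {0..1}" "q \<in> {0..1}" "\<bar>real_of_rat p - real_of_rat q\<bar> < \<delta>" for p q
    proof (cases "p = q")
      case False
      define h where "h = real_of_rat p - real_of_rat q"
      have "h \<noteq> 0" using False by (simp add: h_def)
      have 1: "norm (y (p, False) - y (q, False) - h *\<^sub>R y (q, True)) \<le> \<epsilon> / 3 * \<bar>h\<bar>"
        using \<delta>(2)[OF pq] by (simp add: h_def)
      have 2: "norm (y (q, False) - y (p, False) - (- h) *\<^sub>R y (p, True)) \<le> \<epsilon> / 3 * \<bar>h\<bar>"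
        using \<delta>(2)[OF pq(2,1)] pq(3) by (simp add: h_def abs_minus_commute)
      have "\<bar>h\<bar> * norm (y (p, True) - y (q, True))
          = norm ((y (p, False) - y (q, False) - h *\<^sub>R y (q, True))
              + (y (q, False) - y (p, False) - (- h) *\<^sub>R y (p, True)))"
        unfolding norm_scaleR[symmetric] by (simp add: scaleR_diff_right)
      also have "\<dots> \<le> \<epsilon> / 3 * \<bar>h\<bar> + \<epsilon> / 3 * \<bar>h\<bar>"
        by (rule norm_triangle_mono[OF 1 2])
      also have "\<dots> = \<bar>h\<bar> * (2 * \<epsilon> / 3)" by simp
      finally have "norm (y (p, True) - y (q, True)) \<le> 2 * \<epsilon> / 3"
        using \<open>h \<noteq> 0\<close> by (simp only: mult_le_cancel_left_pos zero_less_abs_iff not_False_eq_True)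
      then show ?thesis using \<open>0 < \<epsilon>\<close> by simp
    qed (use \<open>0 < \<epsilon>\<close> in simp)
    then show "\<exists>d>0. \<forall>x\<in>?X. \<forall>x'\<in>?X. dist x' x < d \<longrightarrow> dist (y (inv x', True)) (y (inv x, True)) < \<epsilon>"
      using \<delta>(1) by (intro exI[of _ \<delta>]) (auto simp: dist_norm inv)
  qed
  from uniformly_continuous_on_extension_on_closure[OF this] obtain g
    where g: "uniformly_continuous_on {0..1} g" "\<And>x. x \<in> ?X \<Longrightarrow> y (inv x, True) = g x"
    unfolding closure_unit_rationals by metis
  then have cont_g: "continuous_on {0..1} g"
    by (simp add: uniformly_continuous_imp_continuous)
  then have "compact (g ` {0..1})" by (intro compact_continuous_image) auto
  then obtain M where M: "\<And>x. x \<in> {0..1} \<Longrightarrow> norm (g x) \<le> M" "0 < M"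
    by (metis compact_imp_bounded bounded_pos image_eqI)
  have "uniformly_continuous_on ?X (\<lambda>x. y (inv x, False))"
    unfolding uniformly_continuous_on_def
  proof (intro allI impI)
    fix \<epsilon> :: real assume "0 < \<epsilon>"
    obtain \<delta> where \<delta>: "0 < \<delta>"
      "\<And>p q. p \<in> {0..1} \<Longrightarrow> q \<in> {0..1} \<Longrightarrow> \<bar>real_of_rat p - real_of_rat q\<bar> < \<delta> \<Longrightarrow>
        norm (y (p, False) - y (q, False) - (of_rat p - of_rat q) *\<^sub>R y (q, True))
          \<le> 1 * \<bar>real_of_rat p - real_of_rat q\<bar>" using C1_code_eps[OF y zero_less_one] by blast
    define d where "d = min \<delta> (\<epsilon> / (1 + M))"
    have "0 < d" using \<delta>(1) \<open>0 < \<epsilon>\<close> M(2) by (simp add: d_def)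
    have "norm (y (p, False) - y (q, False)) < \<epsilon>"
      if pq: "p \<in> {0..1}" "q \<in> {0..1}" "\<bar>real_of_rat p - real_of_rat q\<bar> < d" for p q
    proof -
      define h where "h = real_of_rat p - real_of_rat q"
      have 1: "norm (y (p, False) - y (q, False) - h *\<^sub>R y (q, True)) \<le> \<bar>h\<bar>"
        using \<delta>(2)[OF pq(1,2)] pq(3) by (simp add: h_def d_def)
      have "y (q, True) = g (of_rat q)" using g(2)[of "of_rat q"] pq(2) inv by auto
      moreover have "norm (g (of_rat q)) \<le> M" using M(1)[of "of_rat q"] pq(2) by simp
      ultimately have 2: "norm (h *\<^sub>R y (q, True)) \<le> \<bar>h\<bar> * M"
        by (simp add: mult_left_mono)
      have "norm (y (p, False) - y (q, False)) \<le> \<bar>h\<bar> + \<bar>h\<bar> * M"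
        using norm_triangle_mono[OF 1 2] by simp
      also have "\<dots> = \<bar>h\<bar> * (1 + M)" by (simp add: algebra_simps)
      also have "\<dots> < \<epsilon>" using pq(3) M(2) by (simp add: h_def d_def pos_less_divide_eq)
      finally show ?thesis .
    qed
    then show "\<exists>d>0. \<forall>x\<in>?X. \<forall>x'\<in>?X. dist x' x < d \<longrightarrow> dist (y (inv x', False)) (y (inv x, False)) < \<epsilon>"
      using \<open>0 < d\<close> by (intro exI[of _ d]) (auto simp: dist_norm inv)
  qed
  from uniformly_continuous_on_extension_on_closure[OF this] obtain f
    where f: "uniformly_continuous_on {0..1} f" "\<And>x. x \<in> ?X \<Longrightarrow> y (inv x, False) = f x"
    unfolding closure_unit_rationals by metis
  then have cont_f: "continuous_on {0..1} f"
    by (simp add: uniformly_continuous_imp_continuous)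
  have fp: "f (of_rat p) = y (p, False)" and gp: "g (of_rat p) = y (p, True)" if "p \<in> {0..1}" for p
    using f(2)[of "of_rat p"] g(2)[of "of_rat p"] that by (simp_all add: inv)
  have linear: "\<exists>\<delta>>0. \<forall>s\<in>{0..1}. \<forall>t\<in>{0..1}. \<bar>s - t\<bar> < \<delta> \<longrightarrow>
      norm (f s - f t - (s - t) *\<^sub>R g t) \<le> \<epsilon> * \<bar>s - t\<bar>" if "0 < \<epsilon>" for \<epsilon> :: real
  proof -
    from C1_code_eps[OF y \<open>0 < \<epsilon>\<close>] obtain \<delta> where \<delta>: "0 < \<delta>"
      "\<And>p q. p \<in> {0..1} \<Longrightarrow> q \<in> {0..1} \<Longrightarrow> \<bar>real_of_rat p - real_of_rat q\<bar> < \<delta> \<Longrightarrow>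
        norm (y (p, False) - y (q, False) - (of_rat p - of_rat q) *\<^sub>R y (q, True))
          \<le> \<epsilon> * \<bar>real_of_rat p - real_of_rat q\<bar>" by blast
    have "norm (f s - f t - (s - t) *\<^sub>R g t) \<le> \<epsilon> * \<bar>s - t\<bar>"
      if st: "s \<in> {0..1}" "t \<in> {0..1}" "\<bar>s - t\<bar> < \<delta>" for s t
    proof -
      have "s \<in> closure ?X" "t \<in> closure ?X" using st closure_unit_rationals by auto
      then obtain a b where a: "\<And>n. a n \<in> ?X" "a \<longlonglongrightarrow> s" and b: "\<And>n. b n \<in> ?X" "b \<longlonglongrightarrow> t"
        unfolding closure_sequential by metis
      have ab: "a n \<in> {0..1}" "b n \<in> {0..1}" for n using a(1)[of n] b(1)[of n] by auto
      have lim_f: "(\<lambda>n. f (a n)) \<longlonglongrightarrow> f s" "(\<lambda>n. f (b n)) \<longlonglongrightarrow> f t" "(\<lambda>n. g (b n)) \<longlonglongrightarrow> g t"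
        using continuous_on_tendsto_compose[OF cont_f a(2) st(1)] continuous_on_tendsto_compose[OF cont_f b(2) st(2)]
          continuous_on_tendsto_compose[OF cont_g b(2) st(2)] ab by simp_all
      show ?thesis
      proof (rule tendsto_le)
        show "(\<lambda>n. norm (f (a n) - f (b n) - (a n - b n) *\<^sub>R g (b n))) \<longlonglongrightarrow> norm (f s - f t - (s - t) *\<^sub>R g t)"
          by (intro tendsto_intros lim_f a b)
        show "(\<lambda>n. \<epsilon> * \<bar>a n - b n\<bar>) \<longlonglongrightarrow> \<epsilon> * \<bar>s - t\<bar>" by (intro tendsto_intros a b)
        have "(\<lambda>n. \<bar>a n - b n\<bar>) \<longlonglongrightarrow> \<bar>s - t\<bar>" by (intro tendsto_intros a b)
        then have "\<forall>\<^sub>F n in sequentially. \<bar>a n - b n\<bar> < \<delta>" using st(3) by (rule order_tendstoD)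
        then show "\<forall>\<^sub>F n in sequentially. norm (f (a n) - f (b n) - (a n - b n) *\<^sub>R g (b n)) \<le> \<epsilon> * \<bar>a n - b n\<bar>"
        proof eventually_elim
          case (elim n)
          obtain p q where "p \<in> {0..1}" "q \<in> {0..1}" "a n = of_rat p" "b n = of_rat q" using a(1)[of n] b(1)[of n] by blast
          then show ?case using \<delta>(2)[of p q] elim by (simp add: fp gp)
        qed
      qed simp
    qed
    then show ?thesis using \<delta>(1) by blast
  qed
  have "C1_curve f"
    unfolding C1_curve_def
  proof (intro exI conjI ballI)
    show "continuous_on {0..1} (\<lambda>t. blinfun_scaleR_left (g t))"
      by (intro bounded_linear.continuous_on[OF bounded_linear_blinfun_scaleR_left] cont_g)
    fix t :: real assume t: "t \<in> {0..1}"
    show "(f has_derivative blinfun_apply (blinfun_scaleR_left (g t))) (at t within {0..1})"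
      unfolding has_derivative_within_alt
    proof (intro conjI allI impI)
      show "bounded_linear (blinfun_apply (blinfun_scaleR_left (g t)))"
        by (rule blinfun.bounded_linear_right)
      fix \<epsilon> :: real assume "0 < \<epsilon>"
      then obtain \<delta> where "0 < \<delta>" "\<forall>s\<in>{0..1}. \<forall>t\<in>{0..1}. \<bar>s - t\<bar> < \<delta> \<longrightarrow>
          norm (f s - f t - (s - t) *\<^sub>R g t) \<le> \<epsilon> * \<bar>s - t\<bar>" using linear by blast
      with t show "\<exists>d>0. \<forall>s\<in>{0..1}. norm (s - t) < d \<longrightarrow>
          norm (f s - f t - blinfun_apply (blinfun_scaleR_left (g t)) (s - t)) \<le> \<epsilon> * norm (s - t)"
        by (intro exI[of _ \<delta>]) simp
    qed
  qed
  then show ?thesis using fp by blast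
qed

text \<open>The converse is the mean value inequality, with the uniform continuity of the derivative on the
  compact interval.\<close>

lemma C1_curve_code:
  fixes f :: "real \<Rightarrow> 'a::real_normed_vector"
  assumes "C1_curve f"
  shows "\<exists>y. C1_code y \<and> (\<forall>p. y (p, False) = f (of_rat p))"
proof -
  obtain A where A: "\<And>x. x \<in> {0..1} \<Longrightarrow> (f has_derivative blinfun_apply (A x)) (at x within {0..1})"
    and cont: "continuous_on {0..1} A"
    using assms unfolding C1_curve_def by blast
  have unif: "uniformly_continuous_on {0..1} A"
    by (rule compact_uniformly_continuous[OF cont]) simp
  define y where "y = (\<lambda>(p, b). if b then A (of_rat p) 1 else f (of_rat p))"
  have "C1_code y"
    unfolding C1_code_def
  proof
    fix m :: nat
    have "0 < 1 / real (Suc m)" by simp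
    then obtain \<delta> where \<delta>: "0 < \<delta>"
      "\<And>x x'. x \<in> {0..1} \<Longrightarrow> x' \<in> {0..1} \<Longrightarrow> dist x' x < \<delta> \<Longrightarrow> dist (A x') (A x) < 1 / real (Suc m)"
      using unif unfolding uniformly_continuous_on_def by meson
    obtain k where k: "1 / real (Suc k) < \<delta>" using nat_approx_posE[OF \<delta>(1)] by metis
    have "norm (y (p, False) - y (q, False) - of_rat (p - q) *\<^sub>R y (q, True)) \<le> 1 / Suc m * \<bar>real_of_rat (p - q)\<bar>"
      if pq: "p \<in> {0..1}" "q \<in> {0..1}" "\<bar>p - q\<bar> < 1 / of_nat (Suc k)" for p q
    proof -
      let ?S = "closed_segment (real_of_rat q) (real_of_rat p)"
      have "real_of_rat \<bar>p - q\<bar> < real_of_rat (1 / of_nat (Suc k))"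
        using pq(3) by (simp only: of_rat_less)
      then have "\<bar>real_of_rat p - real_of_rat q\<bar> < 1 / real (Suc k)"
        by (simp only: of_rat_diff[symmetric] abs_of_rat of_rat_divide of_rat_of_nat_eq of_rat_1)
      with k have close: "\<bar>real_of_rat p - real_of_rat q\<bar> < \<delta>" by linarith
      have S: "?S \<subseteq> {0..1}" using pq by (intro closed_segment_subset) auto
      have "norm (f (of_rat p) - f (of_rat q) - blinfun_apply (A (of_rat q)) (of_rat p - of_rat q))
          \<le> norm (real_of_rat p - real_of_rat q) * (1 / Suc m)"
      proof (rule differentiable_bound_linearization[where S = ?S])
        show "of_rat q + t *\<^sub>R (of_rat p - of_rat q) \<in> ?S" if "t \<in> {0..1}" for t :: real
          using that by (auto simp: closed_segment_def algebra_simps intro!: exI[of _ t])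
        show "(f has_derivative blinfun_apply (A x)) (at x within ?S)" if "x \<in> ?S" for x
          using has_derivative_subset[OF A S] that S by blast
        show "onorm (blinfun_apply (A x) - blinfun_apply (A (of_rat q))) \<le> 1 / Suc m" if "x \<in> ?S" for x
        proof -
          have "dist x (of_rat q) \<le> dist (of_rat p) (real_of_rat q)"
            using that dist_in_closed_segment[of x "of_rat q" "of_rat p"] by (simp add: dist_commute)
          then have "dist x (of_rat q) < \<delta>" using close by (simp add: dist_real_def)
          then have "dist (A x) (A (of_rat q)) < 1 / real (Suc m)"
            using \<delta>(2)[of "of_rat q" x] that S pq by auto
          then show ?thesis
            unfolding dist_norm norm_blinfun.rep_eq by (simp add: minus_blinfun.rep_eq fun_diff_def)
        qed
      qed simp
      moreover have "blinfun_apply (A (of_rat q)) (of_rat p - of_rat q)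
          = (of_rat p - of_rat q) *\<^sub>R blinfun_apply (A (of_rat q)) 1"
        using blinfun.scaleR_right[of "A (of_rat q)" "of_rat p - of_rat q" 1] by simp
      ultimately show ?thesis
        by (simp add: y_def of_rat_diff mult.commute)
    qed
    then show "\<exists>k. \<forall>p\<in>{0..1}. \<forall>q\<in>{0..1}. \<bar>p - q\<bar> < 1 / of_nat (Suc k) \<longrightarrow>
        norm (y (p, False) - y (q, False) - of_rat (p - q) *\<^sub>R y (q, True)) \<le> 1 / Suc m * \<bar>real_of_rat (p - q)\<bar>"
      by blast
  qed
  then show ?thesis by (intro exI[of _ y]) (simp add: y_def)
qed

section \<open>The purely unrectifiable closed sets form a coanalytic set\<close>

lemma continuous_map_borel_of_measurable:
  assumes "continuous_map X Y f"
  shows "f \<in> borel_of X \<rightarrow>\<^sub>M borel_of Y"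
  unfolding borel_of_def[of Y]
proof (rule measurable_measure_of)
  show "{U. openin Y U} \<subseteq> Pow (topspace Y)" by (auto dest: openin_subset)
  show "f \<in> space (borel_of X) \<rightarrow> topspace Y"
    using continuous_map_funspace[OF assms] by simp
  fix U assume "U \<in> {U. openin Y U}"
  then have "openin X {x \<in> topspace X. f x \<in> U}"
    using openin_continuous_map_preimage[OF assms] by simp
  moreover have "f -` U \<inter> space (borel_of X) = {x \<in> topspace X. f x \<in> U}" by auto
  ultimately show "f -` U \<inter> space (borel_of X) \<in> sets (borel_of X)"
    by (auto simp: sets_borel_of intro: sigma_sets.Basic)
qed

text \<open>The witness space may be any Polish space: it is replaced by a homeomorphic copy whose points are
  real sequences.\<close>

lemma sigma11_fst_image:
  assumes Y: "polish_topology Y" and B: "B \<in> sets (borel_of (prod_topology X Y))"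
  shows "sigma11 X (fst ` B)"
proof -
  obtain Y' :: "(nat \<Rightarrow> real) topology" where Y': "polish_topology Y'" "Y homeomorphic_space Y'"
    using polish_topology_copy[OF Y] by blast
  then obtain h k where hk: "continuous_map Y Y' h" "continuous_map Y' Y k"
      "\<And>y. y \<in> topspace Y \<Longrightarrow> k (h y) = y"
    unfolding homeomorphic_space_def homeomorphic_maps_def by blast
  let ?\<phi> = "\<lambda>w. (fst w, k (snd w))"
  have "continuous_map (prod_topology X Y') (prod_topology X Y) ?\<phi>"
    using continuous_map_compose[OF continuous_map_snd hk(2), of X]
    by (intro continuous_map_pairedI continuous_map_fst) (simp add: comp_def)
  then have "?\<phi> \<in> borel_of (prod_topology X Y') \<rightarrow>\<^sub>M borel_of (prod_topology X Y)"
    by (rule continuous_map_borel_of_measurable)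
  from measurable_sets[OF this B]
  have "?\<phi> -` B \<inter> topspace (prod_topology X Y') \<in> sets (borel_of (prod_topology X Y'))" by simp
  moreover have "fst ` B = fst ` (?\<phi> -` B \<inter> topspace (prod_topology X Y'))"
  proof
    show "fst ` B \<subseteq> fst ` (?\<phi> -` B \<inter> topspace (prod_topology X Y'))"
    proof (rule image_subsetI)
      fix w assume w: "w \<in> B"
      then have top: "fst w \<in> topspace X" "snd w \<in> topspace Y"
        using sets.sets_into_space[OF B] by (auto simp: mem_Times_iff)
      then have "h (snd w) \<in> topspace Y'" using continuous_map_funspace[OF hk(1)] by auto
      with w top have "(fst w, h (snd w)) \<in> ?\<phi> -` B \<inter> topspace (prod_topology X Y')"
        by (simp add: hk(3))
      then show "fst w \<in> fst ` (?\<phi> -` B \<inter> topspace (prod_topology X Y'))" by (rule rev_image_eqI) simp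
    qed
  qed force
  ultimately show ?thesis unfolding sigma11_def using Y'(1) by blast
qed

lemma polish_topology_euclidean: "polish_topology (euclidean :: 'a::polish_space topology)"
  unfolding polish_topology_def
  by (simp add: completely_metrizable_space_euclidean second_countable_imp_separable_space
      second_countable_euclidean)

lemma closed_in_borel_of_euclidean: "closed F \<Longrightarrow> F \<in> sets (borel_of euclidean)"
  using sets.compl_sets[of "- F" "borel_of euclidean"]
  by (auto simp: sets_borel_of double_complement Compl_eq_Diff_UNIV[symmetric] intro: sigma_sets.Basic)

lemma C1_curve_image_subset_iff:
  fixes f :: "real \<Rightarrow> 'a::real_normed_vector"
  assumes "C1_curve f" "closed S"
  shows "f ` {0..1} \<subseteq> S \<longleftrightarrow> (\<forall>p\<in>{0..1}. f (of_rat p) \<in> S)"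
proof
  assume *: "\<forall>p\<in>{0..1}. f (of_rat p) \<in> S"
  have "continuous_on {0..1} f"
    using assms(1) unfolding C1_curve_def by (meson has_derivative_continuous_on)
  then show "f ` {0..1} \<subseteq> S"
    using image_closure_subset[of "real_of_rat ` {0..1}" f S] * assms(2) closure_unit_rationals by auto
qed auto

lemma C1_code_borel:
  "{y :: rat \<times> bool \<Rightarrow> 'a::{real_normed_vector, second_countable_topology}. C1_code y} \<in> sets (borel_of euclidean)"
proof -
  define S where "S m k = {y :: rat \<times> bool \<Rightarrow> 'a. \<forall>p\<in>{0..1}. \<forall>q\<in>{0..1}. \<bar>p - q\<bar> < 1 / of_nat (Suc k) \<longrightarrow>
      norm (y (p, False) - y (q, False) - of_rat (p - q) *\<^sub>R y (q, True)) \<le> 1 / Suc m * \<bar>real_of_rat (p - q)\<bar>}" for m k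
  have "closed (S m k)" for m k
  proof -
    have "S m k = (\<Inter>p\<in>{0..1}. \<Inter>q\<in>{q \<in> {0..1}. \<bar>p - q\<bar> < 1 / of_nat (Suc k)}.
        {y. norm (y (p, False) - y (q, False) - of_rat (p - q) *\<^sub>R y (q, True)) \<le> 1 / Suc m * \<bar>real_of_rat (p - q)\<bar>})"
      unfolding S_def by blast
    also have "closed \<dots>"
      by (intro closed_INT ballI closed_Collect_le continuous_intros continuous_on_product_coordinates)
    finally show ?thesis .
  qed
  then have "(\<Inter>m. \<Union>k. S m k) \<in> sets (borel_of euclidean)"
    by (intro sets.countable_INT sets.countable_UN) (auto intro: closed_in_borel_of_euclidean)
  moreover have "{y. C1_code y} = (\<Inter>m. \<Union>k. S m k)"
    unfolding C1_code_def S_def by blast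
  ultimately show ?thesis by simp
qed

text \<open>A closed set fails to be purely unrectifiable if and only if some code \<open>y\<close> describes a curve that meets
  it in positive measure. Both conditions are Borel in the pair: the measure condition is a countable
  combination of the rectangles \<open>E p \<times> F p\<close>, where \<open>E p\<close> says which balls the set misses and \<open>F p\<close> that the
  coded curve stays in a finite union of closed balls.\<close>

theorem pi11_purely_unrectifiable:
  fixes T :: "'a::{real_normed_vector, polish_space} set topology"
  assumes T: "effros_polish_topology T"
  shows "pi11 T {A. closed A \<and> purely_unrectifiable A}"
proof -
  have topT: "topspace T = {A. closed A}" and setsT: "sets (borel_of T) = sets effros"
    using T unfolding effros_polish_topology_def by auto
  define Y where "Y = (euclidean :: (rat \<times> bool \<Rightarrow> 'a) topology)"
  define N where "N = borel_of (prod_topology T Y)"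
  have spaceN: "space N = {A. closed A} \<times> UNIV" by (simp add: N_def Y_def topT)
  obtain D :: "'a set" where D: "countable D" "\<And>X. open X \<Longrightarrow> X \<noteq> {} \<Longrightarrow> \<exists>x\<in>D. x \<in> X"
    using countable_dense_setE by blast
  define d where "d = from_nat_into D"
  have dense: "\<exists>i. dist (d i) x < e" if "0 < e" for x e
  proof -
    have "ball x e \<noteq> {}" using that by simp
    with D(2)[OF open_ball, of x e] obtain a where "a \<in> D" "a \<in> ball x e" by blast
    then show ?thesis using D(1) by (intro exI[of _ "to_nat_on D a"]) (simp add: d_def dist_commute)
  qed
  define L :: "nat \<Rightarrow> ((nat \<times> rat) list \<times> (nat \<times> rat) list) set" where
    "L k = {(U, W). (\<forall>(i, r)\<in>set U. 0 < r) \<and> (\<Sum>(i, r)\<leftarrow>U. real_of_rat r) < 1 / Suc k}" for k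
  define E :: "(nat \<times> rat) list \<times> (nat \<times> rat) list \<Rightarrow> 'a set set" where
    "E p = {A. closed A \<and> (\<forall>(i, r)\<in>set (snd p). 0 < r \<and> A \<inter> ball (d i) (2 * of_rat r) = {})}" for p
  define S :: "(nat \<times> rat) list \<times> (nat \<times> rat) list \<Rightarrow> 'a set" where
    "S p = (\<Union>(i, r)\<in>set (fst p). cball (d i) (of_rat r)) \<union> (\<Union>(i, r)\<in>set (snd p). cball (d i) (of_rat r))" for p
  define F :: "(nat \<times> rat) list \<times> (nat \<times> rat) list \<Rightarrow> (rat \<times> bool \<Rightarrow> 'a) set" where
    "F p = {y. \<forall>q\<in>{0..1}. y (q, False) \<in> S p}" for p
  have closedS: "closed (S p)" for p
    unfolding S_def by (intro closed_Un closed_UN) (auto split: prod.splits)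
  define null where "null A y \<longleftrightarrow> (\<forall>k. \<exists>p\<in>L k. A \<in> E p \<and> y \<in> F p)" for A y
  have null_iff: "hausdorff1 (A \<inter> f ` {0..1}) = 0 \<longleftrightarrow> null A y"
    if A: "closed A" and f: "C1_curve f" and y: "\<And>p. p \<in> {0..1} \<Longrightarrow> y (p, False) = f (of_rat p)" for A f y
  proof -
    have "continuous_on {0..1} f"
      using f unfolding C1_curve_def by (meson has_derivative_continuous_on)
    then have "compact (f ` {0..1})" by (intro compact_continuous_image) auto
    moreover have "y \<in> F p \<longleftrightarrow> f ` {0..1} \<subseteq> S p" for p
      unfolding C1_curve_image_subset_iff[OF f closedS] F_def using y by simp
    ultimately have "null A y \<longleftrightarrow> (\<forall>k. \<exists>U W.
        (\<forall>(i, r)\<in>set U. 0 < r) \<and> (\<Sum>(i, r)\<leftarrow>U. real_of_rat r) < 1 / Suc k \<and>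
        (\<forall>(i, r)\<in>set W. 0 < r \<and> A \<inter> ball (d i) (2 * of_rat r) = {}) \<and>
        f ` {0..1} \<subseteq> (\<Union>(i, r)\<in>set U. cball (d i) (of_rat r)) \<union> (\<Union>(i, r)\<in>set W. cball (d i) (of_rat r)))"
      using A by (simp add: null_def L_def E_def S_def Bex_def conj_assoc)
    also have "\<dots> \<longleftrightarrow> hausdorff1 (A \<inter> f ` {0..1}) = 0"
      by (rule hausdorff1_closed_Int_compact_eq_0_iff[of d, OF dense A \<open>compact (f ` {0..1})\<close>, symmetric])
    finally show ?thesis by (rule sym)
  qed
  define B where "B = {(A, y). closed A \<and> C1_code y \<and> \<not> null A y}"
  have "fst \<in> N \<rightarrow>\<^sub>M borel_of T" "snd \<in> N \<rightarrow>\<^sub>M borel_of Y"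
    unfolding N_def by (intro continuous_map_borel_of_measurable continuous_map_fst continuous_map_snd)+
  note meas = measurable_sets[OF this(1)] measurable_sets[OF this(2)]
  have E: "E p \<in> sets (borel_of T)" for p
  proof -
    have "{A. closed A} - {A. closed A \<and> A \<inter> ball (d i) (2 * of_rat r) \<noteq> {}} \<in> sets effros" for i and r :: rat
      using sets.Diff[OF sets.top effros_open[OF open_ball]] by simp
    moreover have "{} \<in> sets effros" by simp
    ultimately have miss: "{A. closed A \<and> 0 < r \<and> A \<inter> ball (d i) (2 * of_rat r) = {}} \<in> sets effros" for i and r :: rat
      by (cases "0 < r") (simp_all add: set_diff_eq conj_disj_distribL cong: conj_cong)
    have "E (U, W) \<in> sets effros" for U W
    proof (induction W)
      case Nil
      then show ?case using sets.top[of "effros :: 'a set measure"] by (simp add: E_def)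
    next
      case (Cons q W)
      obtain i r where "q = (i, r)" by (cases q)
      then have "E (U, q # W) = {A. closed A \<and> 0 < r \<and> A \<inter> ball (d i) (2 * of_rat r) = {}} \<inter> E (U, W)"
        by (auto simp: E_def)
      then show ?case using miss Cons.IH by (simp only: sets.Int)
    qed
    then show ?thesis unfolding setsT by (metis surj_pair)
  qed
  have F: "F p \<in> sets (borel_of Y)" for p
  proof -
    have "F p = (\<Inter>q\<in>{0..1}. (\<lambda>y. y (q, False)) -` S p)" unfolding F_def by blast
    also have "closed \<dots>"
      by (intro closed_INT ballI closed_vimage closedS continuous_on_product_coordinates)
    finally show ?thesis unfolding Y_def by (rule closed_in_borel_of_euclidean)
  qed
  define R where "R = (\<Inter>k. \<Union>p\<in>L k. (fst -` E p \<inter> space N) \<inter> (snd -` F p \<inter> space N))"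
  have R: "(A, y) \<in> R \<longleftrightarrow> null A y" if "closed A" for A y
    using that by (simp add: R_def null_def spaceN)
  have "B = (snd -` {y. C1_code y} \<inter> space N) - R"
    by (rule set_eqI) (auto simp: B_def spaceN R)
  also have "\<dots> \<in> sets N"
    unfolding R_def
    by (intro sets.Diff sets.countable_INT sets.countable_UN'' sets.Int meas image_subsetI E F)
      (simp_all add: Y_def C1_code_borel)
  finally have "sigma11 T (fst ` B)"
    unfolding N_def Y_def using sigma11_fst_image[OF polish_topology_euclidean] by blast
  moreover have "fst ` B = topspace T - {A. closed A \<and> purely_unrectifiable A}"
  proof (intro set_eqI iffI)
    fix A assume "A \<in> fst ` B"
    then obtain y where y: "closed A" "C1_code y" "\<not> null A y" unfolding B_def by auto
    obtain f where f: "C1_curve f" "\<And>p. p \<in> {0..1} \<Longrightarrow> f (of_rat p) = y (p, False)"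
      using C1_code_curve[OF y(2)] by blast
    have "hausdorff1 (A \<inter> f ` {0..1}) \<noteq> 0" using null_iff[OF y(1) f(1), of y] f(2) y(3) by simp
    then show "A \<in> topspace T - {A. closed A \<and> purely_unrectifiable A}"
      using y(1) f(1) unfolding purely_unrectifiable_def topT by blast
  next
    fix A assume "A \<in> topspace T - {A. closed A \<and> purely_unrectifiable A}"
    then obtain f where f: "closed A" "C1_curve f" "hausdorff1 (A \<inter> f ` {0..1}) \<noteq> 0"
      unfolding purely_unrectifiable_def topT by blast
    obtain y where y: "C1_code y" "\<And>p. y (p, False) = f (of_rat p)"
      using C1_curve_code[OF f(2)] by blast
    have "(A, y) \<in> B" using f(1) y(1) null_iff[OF f(1,2), of y] y(2) f(3) by (simp add: B_def)
    then show "A \<in> fst ` B" by (rule rev_image_eqI) simp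
  qed
  ultimately show ?thesis unfolding pi11_def topT by auto
qed

section \<open>A closed set built from a tree\<close>

instance ell2 :: banach ..

lift_definition unit_ell2 :: "nat \<Rightarrow> ell2" is "\<lambda>i j. if j = i then 1 else 0"
  by (rule summable_finite[of "{_}"]) auto

lemma coord_unit_ell2 [simp]: "coord (unit_ell2 i) j = (if j = i then 1 else 0)"
  by (simp add: unit_ell2.rep_eq)

lemma norm_unit_ell2 [simp]: "norm (unit_ell2 i) = 1"
proof -
  have "(norm (unit_ell2 i))\<^sup>2 = (\<Sum>j. if j = i then 1 else 0)"
    unfolding norm_ell2_square by (rule suminf_cong) simp
  also have "\<dots> = 1" using suminf_finite[of "{i}" "\<lambda>j. if j = i then 1 else 0 :: real"] by simp
  finally show ?thesis using norm_ge_zero[of "unit_ell2 i"] by (simp only: power2_eq_1_iff) linarith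
qed

lemma coord_sum: "coord (sum f A) i = (\<Sum>k\<in>A. coord (f k) i)"
  by (induction A rule: infinite_finite_induct) auto

text \<open>Every nonempty finite sequence owns a coordinate, and \<open>node_vec s\<close> has the entry \<open>(1 / 2) ^ length t\<close> at the
  coordinate of each nonempty initial segment \<open>t\<close> of \<open>s\<close>. Along a branch these vectors converge, while
  the vectors of sequences that split after \<open>n\<close> entries are at distance at least \<open>(1 / 2) ^ (n + 1)\<close>.
  Coordinate \<open>0\<close> is left free as the direction of a segment.\<close>

definition node_vec :: "nat list \<Rightarrow> ell2"
  where "node_vec s = (\<Sum>k<length s. (1 / 2) ^ Suc k *\<^sub>R unit_ell2 (Suc (to_nat (take (Suc k) s))))"

lemma node_vec_append: "node_vec (s @ [m]) = node_vec s + (1 / 2) ^ Suc (length s) *\<^sub>R unit_ell2 (Suc (to_nat (s @ [m])))"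
  by (simp add: node_vec_def)

text \<open>For \<open>j = 0, \<dots>, length s\<close> these points form an equidistant net of a unit segment that starts at
  \<open>node_vec s\<close>; at the root, the division by zero leaves the single point \<open>0\<close>.\<close>

definition node_point :: "nat list \<Rightarrow> nat \<Rightarrow> ell2"
  where "node_point s j = node_vec s + (real j / real (length s)) *\<^sub>R unit_ell2 0"

lemma coord_node_point:
  assumes "t \<noteq> []"
  shows "coord (node_point s j) (Suc (to_nat t)) = (if take (length t) s = t then (1 / 2) ^ length t else 0)"
proof -
  have "coord (node_point s j) (Suc (to_nat t))
      = (\<Sum>k<length s. if take (Suc k) s = t then (1 / 2) ^ Suc k else 0)"
    unfolding node_point_def node_vec_def coord_simps coord_sum
    by (auto intro!: sum.cong)
  also have "\<dots> = (\<Sum>k<length s. if k = length t - 1 then (if take (length t) s = t then (1 / 2) ^ length t else 0) else 0)"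
  proof (rule sum.cong)
    fix k assume "k \<in> {..<length s}"
    then have "Suc k = length t" if "take (Suc k) s = t" using that by auto
    then show "(if take (Suc k) s = t then (1 / 2) ^ Suc k else 0)
        = (if k = length t - 1 then (if take (length t) s = t then (1 / 2) ^ length t else 0) else 0 :: real)"
      using assms by (cases "take (Suc k) s = t") auto
  qed simp
  also have "\<dots> = (if take (length t) s = t then (1 / 2) ^ length t else 0)"
    using assms by auto
  finally show ?thesis .
qed

definition tree_points :: "nat list set \<Rightarrow> ell2 set"
  where "tree_points T = {node_point s j | s j. s \<in> T \<and> j \<le> length s}"

lemma countable_tree_points: "countable (tree_points T)"
proof -
  have "tree_points T \<subseteq> (\<lambda>(s, j). node_point s j) ` UNIV"
    by (auto simp: tree_points_def)
  then show ?thesis by (rule countable_subset) simp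
qed

text \<open>A point outside the set can only be a limit of points that belong to extensions of a single child
  of \<open>t\<close>. The node \<open>t\<close> itself contributes finitely many points, and points belonging to different
  children differ in the coordinate of a child by \<open>(1 / 2) ^ (length t + 1)\<close>, so closure and the union over the
  children commute.\<close>

lemma closure_tree_points_child:
  assumes x: "x \<in> closure (tree_points {s \<in> T. take (length t) s = t})" "x \<notin> tree_points T"
  shows "\<exists>m. x \<in> closure (tree_points {s \<in> T. take (Suc (length t)) s = t @ [m]})"
proof -
  define C where "C m = {s \<in> T. take (Suc (length t)) s = t @ [m]}" for m
  define F where "F = {node_point t j | j. t \<in> T \<and> j \<le> length t}"
  define \<delta> :: real where "\<delta> = (1 / 2) ^ Suc (length t)"
  have "0 < \<delta>" by (simp add: \<delta>_def)
  have "finite F" unfolding F_def by simp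
  have "s = t \<or> (\<exists>m. take (Suc (length t)) s = t @ [m])" if "take (length t) s = t" for s
    using that by (metis le_less_linear take_Suc_conv_app_nth take_all_iff)
  then have "tree_points {s \<in> T. take (length t) s = t} \<subseteq> F \<union> (\<Union>m. tree_points (C m))"
    unfolding tree_points_def F_def C_def by blast
  then have "x \<in> closure (F \<union> (\<Union>m. tree_points (C m)))"
    using x(1) closure_mono by blast
  moreover have "F \<subseteq> tree_points T" unfolding F_def tree_points_def by blast
  with x(2) have "x \<notin> closure F" using closure_closed[OF finite_imp_closed[OF \<open>finite F\<close>]] by blast
  ultimately have cl: "x \<in> closure (\<Union>m. tree_points (C m))" by simp
  have far: "\<delta> \<le> dist p p'" if "p \<in> tree_points (C m)" "p' \<in> tree_points (C m')" "m \<noteq> m'" for p p' m m'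
  proof -
    have "coord p (Suc (to_nat (t @ [m]))) = \<delta>" "coord p' (Suc (to_nat (t @ [m]))) = 0"
      using that by (auto simp: tree_points_def C_def coord_node_point \<delta>_def)
    then show ?thesis
      using abs_coord_le_norm[of "p - p'" "Suc (to_nat (t @ [m]))"] by (simp add: dist_norm)
  qed
  obtain p where p: "p \<in> (\<Union>m. tree_points (C m))" "dist p x < \<delta> / 2"
    using cl \<open>0 < \<delta>\<close> unfolding closure_approachable by (meson half_gt_zero_iff)
  then obtain m where m: "p \<in> tree_points (C m)" by blast
  have "x \<in> closure (tree_points (C m))"
    unfolding closure_approachable
  proof (intro allI impI)
    fix e :: real assume "0 < e"
    then obtain p' where p': "p' \<in> (\<Union>m. tree_points (C m))" "dist p' x < min e (\<delta> / 2)"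
      using cl \<open>0 < \<delta>\<close> unfolding closure_approachable by (metis half_gt_zero_iff min_less_iff_conj)
    then obtain m' where m': "p' \<in> tree_points (C m')" by blast
    have "dist p p' < \<delta>" using p(2) p'(2) dist_triangle2[of p p' x] by simp
    then have "m = m'" using far[OF m m'] by fastforce
    with m' p' show "\<exists>y\<in>tree_points (C m). dist y x < e" by auto
  qed
  then show ?thesis unfolding C_def by blast
qed

text \<open>A limit point outside the set is followed from child to child, and the nodes passed form an
  infinite branch.\<close>

lemma well_founded_tree_points_closed:
  assumes T: "\<And>s k. s \<in> T \<Longrightarrow> take k s \<in> T" and no_branch: "\<nexists>\<alpha>. \<forall>n. initial \<alpha> n \<in> T"
  shows "closed (tree_points T)"
proof -
  have "x \<in> tree_points T" if x: "x \<in> closure (tree_points T)" for x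
  proof (rule ccontr)
    assume x': "x \<notin> tree_points T"
    define D where "D t = tree_points {s \<in> T. take (length t) s = t}" for t
    have "\<forall>t. \<exists>m. x \<in> closure (D t) \<longrightarrow> x \<in> closure (D (t @ [m]))"
      using closure_tree_points_child[OF _ x'] by (simp add: D_def)
    then obtain h where h: "\<And>t. x \<in> closure (D t) \<Longrightarrow> x \<in> closure (D (t @ [h t]))" by metis
    define u where "u = rec_nat [] (\<lambda>_ t. t @ [h t])"
    have u: "u 0 = []" "u (Suc n) = u n @ [h (u n)]" for n by (simp_all add: u_def)
    have u_initial: "u n = initial (\<lambda>n. h (u n)) n" for n
      by (induction n) (simp_all add: u)
    have "x \<in> closure (D (u n))" for n
      by (induction n) (use x h in \<open>simp_all add: u D_def\<close>)
    then have "D (u n) \<noteq> {}" for n by (metis closure_empty empty_iff)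
    then have "\<exists>s\<in>T. take (length (u n)) s = u n" for n
      unfolding D_def tree_points_def by blast
    then have "u n \<in> T" for n using T by metis
    then show False using no_branch u_initial by metis
  qed
  then show ?thesis unfolding closure_subset_eq[symmetric] by (rule subsetI)
qed

text \<open>Along a branch the segments converge and their nets become dense.\<close>

lemma branch_segment:
  assumes "\<And>n. initial \<alpha> n \<in> T"
  obtains w where "\<And>t. t \<in> {0..1} \<Longrightarrow> w + t *\<^sub>R unit_ell2 0 \<in> closure (tree_points T)"
proof -
  define g where "g k = (1 / 2 :: real) ^ Suc k *\<^sub>R unit_ell2 (Suc (to_nat (initial \<alpha> (Suc k))))" for k
  have "node_vec (initial \<alpha> n) = (\<Sum>k<n. g k)" for n
    by (induction n) (simp_all add: node_vec_append g_def, simp add: node_vec_def)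
  moreover have "summable g"
  proof (rule summable_norm_cancel)
    show "summable (\<lambda>k. norm (g k))" by (simp add: g_def summable_geometric summable_mult)
  qed
  ultimately have lim: "(\<lambda>n. node_vec (initial \<alpha> n)) \<longlonglongrightarrow> suminf g"
    by (simp add: summable_LIMSEQ)
  show thesis
  proof
    fix t :: real assume t: "t \<in> {0..1}"
    have "(\<lambda>n. real (nat \<lfloor>t * real n\<rfloor>) / real n) \<longlonglongrightarrow> t"
    proof (rule real_tendsto_sandwich)
      show "(\<lambda>n. t - 1 / real n) \<longlonglongrightarrow> t"
        using tendsto_diff[OF tendsto_const lim_1_over_n, of t] by simp
      show "\<forall>\<^sub>F n in sequentially. t - 1 / real n \<le> real (nat \<lfloor>t * real n\<rfloor>) / real n"
        using eventually_gt_at_top[of 0]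
      proof eventually_elim
        case (elim n)
        have "t - 1 / real n = (t * real n - 1) / real n" using elim by (simp add: field_simps)
        also have "\<dots> \<le> real (nat \<lfloor>t * real n\<rfloor>) / real n"
          by (intro divide_right_mono) linarith+
        finally show ?case .
      qed
      show "\<forall>\<^sub>F n in sequentially. real (nat \<lfloor>t * real n\<rfloor>) / real n \<le> t"
        using eventually_gt_at_top[of 0]
      proof eventually_elim
        case (elim n)
        have "real (nat \<lfloor>t * real n\<rfloor>) \<le> t * real n" using t by simp
        then show ?case using elim by (simp add: field_simps)
      qed
    qed simp
    then have "(\<lambda>n. node_point (initial \<alpha> n) (nat \<lfloor>t * real n\<rfloor>)) \<longlonglongrightarrow> suminf g + t *\<^sub>R unit_ell2 0"
      unfolding node_point_def by (intro tendsto_intros lim) simp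
    moreover have "node_point (initial \<alpha> n) (nat \<lfloor>t * real n\<rfloor>) \<in> tree_points T" for n
    proof -
      have "nat \<lfloor>t * real n\<rfloor> \<le> n"
        using t mult_right_mono[of t 1 "real n"] by (simp add: nat_le_iff floor_le_iff)
      then show ?thesis using assms[of n] unfolding tree_points_def
        by (intro CollectI exI[of _ "initial \<alpha> n"] exI[of _ "nat \<lfloor>t * real n\<rfloor>"]) simp
    qed
    ultimately show "suminf g + t *\<^sub>R unit_ell2 0 \<in> closure (tree_points T)"
      unfolding closure_sequential
      by (intro exI[of _ "\<lambda>n. node_point (initial \<alpha> n) (nat \<lfloor>t * real n\<rfloor>)"] conjI allI)
  qed
qed

text \<open>Coordinate \<open>0\<close> does not increase distances and maps the segment onto an interval of Lebesgue
  measure \<open>1\<close>. A covering set of diameter \<open>r\<close> is mapped into an interval of length \<open>2 r\<close> around the image of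
  one of its points, so the diameters of a cover sum up to at least \<open>1 / 2\<close>.\<close>

lemma hausdorff1_unit_segment_pos:
  "hausdorff1 ((\<lambda>t. w + t *\<^sub>R unit_ell2 0) ` {0..1}) \<noteq> 0" (is "hausdorff1 ?S \<noteq> 0")
proof
  assume "hausdorff1 ?S = 0"
  then have "hausdorff1_size 1 ?S < ennreal (1 / 2)"
    unfolding hausdorff1_def by (metis SUP_upper ennreal_less_zero_iff greaterThan_iff half_gt_zero_iff le_zero_eq zero_less_one)
  then obtain C where C: "?S \<subseteq> (\<Union>i. C i)" "\<And>i :: nat. bounded (C i)"
      "(\<Sum>i. ennreal (diameter (C i))) < ennreal (1 / 2)"
    unfolding hausdorff1_size_def INF_less_iff by blast
  define J where "J i = (if C i = {} then {} else
    {coord (SOME x. x \<in> C i) 0 - diameter (C i) .. coord (SOME x. x \<in> C i) 0 + diameter (C i)})" for i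
  have J: "emeasure lborel (J i) \<le> 2 * ennreal (diameter (C i))" for i
  proof -
    have "emeasure lborel (J i) \<le> ennreal (2 * diameter (C i))"
      using diameter_ge_0[OF C(2)[of i]] by (simp add: J_def)
    then show ?thesis by (simp add: ennreal_mult')
  qed
  have coord_J: "coord x 0 \<in> J i" if "x \<in> C i" for x i
  proof -
    have "(SOME x. x \<in> C i) \<in> C i" using that by (metis someI)
    then have "dist x (SOME x. x \<in> C i) \<le> diameter (C i)"
      using that C(2) diameter_bounded_bound by blast
    then have "\<bar>coord x 0 - coord (SOME x. x \<in> C i) 0\<bar> \<le> diameter (C i)"
      using abs_coord_le_norm[of "x - (SOME x. x \<in> C i)" 0] by (simp add: dist_norm)
    then show ?thesis using that by (auto simp: J_def)
  qed
  have "{coord w 0 .. coord w 0 + 1} \<subseteq> (\<Union>i. J i)"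
  proof
    fix a assume a: "a \<in> {coord w 0 .. coord w 0 + 1}"
    then have "w + (a - coord w 0) *\<^sub>R unit_ell2 0 \<in> ?S" by (intro imageI) simp
    then obtain i where "w + (a - coord w 0) *\<^sub>R unit_ell2 0 \<in> C i" using C(1) by blast
    from coord_J[OF this] show "a \<in> (\<Union>i. J i)" by auto
  qed
  then have "emeasure lborel {coord w 0 .. coord w 0 + 1} \<le> emeasure lborel (\<Union>i. J i)"
    by (intro emeasure_mono) (auto simp: J_def)
  also have "\<dots> \<le> (\<Sum>i. emeasure lborel (J i))"
    by (intro emeasure_subadditive_countably) (auto simp: J_def)
  also have "\<dots> \<le> (\<Sum>i. 2 * ennreal (diameter (C i)))"
    by (intro suminf_le J) auto
  also have "\<dots> = 2 * (\<Sum>i. ennreal (diameter (C i)))" by simp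
  also have "\<dots> < 2 * ennreal (1 / 2)" using C(3) by (intro ennreal_mult_strict_left_mono) auto
  also have "\<dots> = ennreal (2 * (1 / 2))" by (subst ennreal_mult') simp_all
  finally show False by simp
qed

lemma C1_curve_affine: "C1_curve (\<lambda>t. w + t *\<^sub>R v)"
  unfolding C1_curve_def
proof (intro exI conjI ballI)
  show "continuous_on {0..1} (\<lambda>_ :: real. blinfun_scaleR_left v)" by simp
  show "((\<lambda>t. w + t *\<^sub>R v) has_derivative blinfun_apply (blinfun_scaleR_left v)) (at x within {0..1})" for x
    by (auto intro!: derivative_eq_intros)
qed

section \<open>Reduction of coanalytic sets to pure unrectifiability\<close>

text \<open>With a branch the closure contains a segment, which is a smooth curve of positive measure. Without
  one the closure adds nothing to a countable set, and countable sets have measure zero.\<close>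

lemma tree_points_purely_unrectifiable_iff:
  assumes T: "\<And>s k. s \<in> T \<Longrightarrow> take k s \<in> T"
  shows "purely_unrectifiable (closure (tree_points T)) \<longleftrightarrow> (\<nexists>\<alpha>. \<forall>n. initial \<alpha> n \<in> T)"
proof
  assume pu: "purely_unrectifiable (closure (tree_points T))"
  show "\<nexists>\<alpha>. \<forall>n. initial \<alpha> n \<in> T"
  proof
    assume "\<exists>\<alpha>. \<forall>n. initial \<alpha> n \<in> T"
    then obtain \<alpha> where "\<And>n. initial \<alpha> n \<in> T" by blast
    from branch_segment[of \<alpha> T, OF this] obtain w
      where w: "\<And>t. t \<in> {0..1} \<Longrightarrow> w + t *\<^sub>R unit_ell2 0 \<in> closure (tree_points T)" by blast
    let ?f = "\<lambda>t. w + t *\<^sub>R unit_ell2 0"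
    have "closure (tree_points T) \<inter> ?f ` {0..1} = ?f ` {0..1}" using w by blast
    moreover have "hausdorff1 (closure (tree_points T) \<inter> ?f ` {0..1}) = 0"
      using pu C1_curve_affine unfolding purely_unrectifiable_def by blast
    ultimately show False using hausdorff1_unit_segment_pos[of w] by simp
  qed
next
  assume "\<nexists>\<alpha>. \<forall>n. initial \<alpha> n \<in> T"
  then have "closure (tree_points T) = tree_points T"
    using well_founded_tree_points_closed[of T, OF T] by simp
  then have "countable (closure (tree_points T) \<inter> X)" for X
    using countable_tree_points[of T] by (simp add: countable_Int1)
  then show "purely_unrectifiable (closure (tree_points T))"
    unfolding purely_unrectifiable_def by (simp add: hausdorff1_countable)
qed

text \<open>An open set meets a closure if and only if it meets the set itself, and the candidate points are
  countably many fixed points. So hitting a ball is a countable union of the conditions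
  \<open>s \<in> T z\<close>.\<close>

lemma closure_tree_points_measurable:
  assumes "\<And>s. {z \<in> space M. s \<in> T z} \<in> sets M"
  shows "(\<lambda>z. closure (tree_points (T z))) \<in> M \<rightarrow>\<^sub>M effros"
  unfolding effros_def
proof (rule measurable_measure_of)
  show "(\<lambda>z. closure (tree_points (T z))) \<in> space M \<rightarrow> {A. closed A}" by simp
  fix X :: "ell2 set set" assume "X \<in> {{A. closed A \<and> A \<inter> ball x r \<noteq> {}} | x r. 0 < r}"
  then obtain x r where X: "X = {A. closed A \<and> A \<inter> ball x r \<noteq> {}}" by blast
  have "(\<lambda>z. closure (tree_points (T z))) -` X \<inter> space M
      = {z \<in> space M. tree_points (T z) \<inter> ball x r \<noteq> {}}"
    unfolding X using open_Int_closure_eq_empty[OF open_ball[of x r]] by (auto simp: Int_commute)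
  also have "\<dots> = (\<Union>s\<in>{s. \<exists>j\<le>length s. node_point s j \<in> ball x r}. {z \<in> space M. s \<in> T z})"
    unfolding tree_points_def by blast
  also have "\<dots> \<in> sets M"
    using assms by (intro sets.countable_UN'') auto
  finally show "(\<lambda>z. closure (tree_points (T z))) -` X \<inter> space M \<in> sets M" .
qed auto

theorem pi11_hard_purely_unrectifiable:
  fixes T :: "ell2 set topology"
  assumes T: "effros_polish_topology T"
  shows "pi11_hard TYPE('b) T {A. closed A \<and> purely_unrectifiable A}"
  unfolding pi11_hard_def
proof (intro allI impI)
  fix Z :: "'b topology" and B
  assume "pi11 Z B"
  then obtain S where S: "\<And>s. {z \<in> topspace Z. s \<in> S z} \<in> sets (borel_of Z)"
    "\<And>z s k. s \<in> S z \<Longrightarrow> take k s \<in> S z"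
    "\<And>z. z \<in> topspace Z \<Longrightarrow> z \<in> B \<longleftrightarrow> (\<nexists>\<alpha>. \<forall>n. initial \<alpha> n \<in> S z)"
    by (rule coanalytic_well_founded_trees) blast
  have "(\<lambda>z. closure (tree_points (S z))) \<in> borel_of Z \<rightarrow>\<^sub>M effros"
    using S(1) by (intro closure_tree_points_measurable) simp
  moreover have "borel_of Z \<rightarrow>\<^sub>M borel_of T = borel_of Z \<rightarrow>\<^sub>M effros"
    using T by (intro measurable_cong_sets) (simp_all add: effros_polish_topology_def)
  ultimately show "borel_wadge_reducible Z B T {A. closed A \<and> purely_unrectifiable A}"
    unfolding borel_wadge_reducible_def
    using S(3) tree_points_purely_unrectifiable_iff[OF S(2)]
    by (intro bexI[of _ "\<lambda>z. closure (tree_points (S z))"]) simp_all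
qed

theorem theorem7:
  fixes T :: "ell2 set topology"
  assumes "effros_polish_topology T"
  shows "pi11_complete TYPE('b) T {A. closed A \<and> purely_unrectifiable A}"
  unfolding pi11_complete_def
  using pi11_purely_unrectifiable[OF assms] pi11_hard_purely_unrectifiable[OF assms] by blast

end
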